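(* Let $(G_n)_{n\in\omega}$ be a balanced tower of topological groups, and let $G=\bigcup_{n\in\omega}G_n$. Then the semitopological group $\overrightarrow{G}=(G,\overrightarrow{\tau})$ is a topological group, and hence all of the following hold, where $\overleftarrow{G}=(G,\overleftarrow{\tau})$, $\overset{\rightleftharpoons}{G}=(G,\overset{\rightleftharpoons}{\tau})$, $\overleftrightarrow{G}=(G,\overleftrightarrow{\tau})$: $\overleftarrow{G}$, $\overset{\rightleftharpoons}{G}$ and $\overleftrightarrow{G}$ are topological groups; the identity map $\overleftrightarrow{G}\to\overset{\rightleftharpoons}{G}$ is continuous; and the identity maps $\overset{\rightleftharpoons}{G}\to\mathrm{g}\text{-}\varinjlim G_n$ and $\overleftrightarrow{G}\to\mathrm{g}\text{-}\varinjlim G_n$ are homeomorphisms. In particular, the topology of $\mathrm{g}\text{-}\varinjlim G_n$ coincides with each of the topologies $\overrightarrow{\tau}$, $\overleftarrow{\tau}$, $\overset{\rightleftharpoons}{\tau}$, $\overleftrightarrow{\tau}$.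
   Context: $\omega=\{0,1,2,\dots\}$. Topological groups are not assumed Hausdorff. A tower of topological groups is a sequence $G_0\subset G_1\subset G_2\subset\cdots$ of topological groups in which each $G_n$ is a topological subgroup of $G_{n+1}$ (a subgroup carrying the subspace topology); $G=\bigcup_{n\in\omega}G_n$ is its union, a group with neutral element $e$. Balanced triples and towers: for a group $K$, a subgroup $H\subset K$ and a subset $U\subset K$ put $\sqrt[H]{U}=\{x\in K: hxh^{-1}\in U\text{ for all }h\in H\}$ (the largest subset of $U$ invariant under conjugation by elements of $H$). A triple $(K,\Gamma,H)$ of topological groups $H\subset\Gamma\subset K$ (topological subgroups) is balanced if for any neighborhoods $V\subset\Gamma$ and $U\subset K$ of the neutral element $e$ (in $\Gamma$ and in $K$, respectively) the product $V\cdot\sqrt[H]{U}$ is a neighborhood of $e$ in $K$. A tower $(G_n)_{n\in\omega}$ is balanced if each triple $(G_{n+2},G_{n+1},G_n)$, $n\in\omega$, is balanced. $\mathrm{g}\text{-}\varinjlim G_n$ is the group $G$ endowed with the strongest (not necessarily Hausdorff) topology that turns $G$ into a topological group and makes all the inclusions $G_n\to G$, $n\in\omega$, continuous. For each $n$ fix a neighborhood base $\mathcal B_n$ at $e$ in $G_n$ consisting of open symmetric neighborhoods $U=U^{-1}\subset G_n$ of $e$. For a sequence $(U_n)_{n\in\omega}$ of subsets of $G$ put $$\overrightarrow{\prod}_{n\in\omega}U_n=\bigcup_{m\in\omega}U_0U_1\cdots U_m,\qquad \overleftarrow{\prod}_{n\in\omega}U_n=\bigcup_{m\in\omega}U_m\cdots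 U_1U_0,\qquad \overleftrightarrow{\prod}_{n\in\omega}U_n=\bigcup_{m\in\omega}U_m\cdots U_1U_0\,U_0U_1\cdots U_m .$$ Four topologies on $G$ are defined by the following bases, where $x,y$ range over $G$ and $(U_n)_{n\in\omega}$ over $\prod_{n\in\omega}\mathcal B_n$: - $\overrightarrow{\tau}$: the sets $\big(\overrightarrow{\prod}_{n\in\omega}U_n\big)\cdot x$; - $\overleftarrow{\tau}$: the sets $x\cdot\big(\overleftarrow{\prod}_{n\in\omega}U_n\big)$; - $\overleftrightarrow{\tau}$: the sets $x\cdot\big(\overleftrightarrow{\prod}_{n\in\omega}U_n\big)\cdot y$; - $\overset{\rightleftharpoons}{\tau}$: the sets $x\big(\overleftarrow{\prod}_{n\in\omega}U_n\big)\cap\big(\overrightarrow{\prod}_{n\in\omega}U_n\big)y$. With each of these topologies $G$ is a semitopological group (left and right translations are continuous); neighborhood bases at $e$ are given respectively by the sets $\overrightarrow{\prod}_{n}U_n$, $\overleftarrow{\prod}_{n}U_n$, $\overleftrightarrow{\prod}_{n}U_n$ and $\big(\overrightarrow{\prod}_{n}U_n\big)\cap\big(\overleftarrow{\prod}_{n}U_n\big)$, with $(U_n)\in\prod_n\mathcal B_n$. *)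

theory Defs
  imports "HOL-Algebra.Coset" "HOL-Analysis.Analysis"
begin

(* Not assumed Hausdorff. *)
definition topological_group :: "('a, 'b) monoid_scheme \<Rightarrow> 'a topology \<Rightarrow> bool" where
  "topological_group G T \<longleftrightarrow>
     group G \<and> topspace T = carrier G \<and>
     continuous_map (prod_topology T T) T (\<lambda>(x, y). x \<otimes>\<^bsub>G\<^esub> y) \<and>
     continuous_map T T (\<lambda>x. inv\<^bsub>G\<^esub> x)"

(* Neighborhoods need not be open. *)
definition nbhd :: "'a topology \<Rightarrow> 'a \<Rightarrow> 'a set \<Rightarrow> bool" where
  "nbhd T x V \<longleftrightarrow> V \<subseteq> topspace T \<and> x \<in> T interior_of V"

definition conj_root :: "('a, 'b) monoid_scheme \<Rightarrow> 'a set \<Rightarrow> 'a set \<Rightarrow> 'a set" where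
  "conj_root K H U = {x \<in> carrier K. \<forall>h\<in>H. h \<otimes>\<^bsub>K\<^esub> x \<otimes>\<^bsub>K\<^esub> inv\<^bsub>K\<^esub> h \<in> U}"

(* The triple (K, \<Gamma>, H), where TK is the topology of K, T\<Gamma> is the topology of \<Gamma> = topspace T\<Gamma>,
   and the topology of H is irrelevant. *)
definition balanced_triple ::
    "('a, 'b) monoid_scheme \<Rightarrow> 'a topology \<Rightarrow> 'a topology \<Rightarrow> 'a set \<Rightarrow> bool" where
  "balanced_triple K TK T\<Gamma> H \<longleftrightarrow>
     (\<forall>V U. nbhd T\<Gamma> \<one>\<^bsub>K\<^esub> V \<and> nbhd TK \<one>\<^bsub>K\<^esub> U \<longrightarrow>
        nbhd TK \<one>\<^bsub>K\<^esub> (V <#>\<^bsub>K\<^esub> conj_root K H U))"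

(* A tower is given by its union G and the topologies T n of the groups G_n. The underlying set of
   G_n is topspace (T n) and its operation is that of G. *)
definition tower_group :: "('a, 'b) monoid_scheme \<Rightarrow> (nat \<Rightarrow> 'a topology) \<Rightarrow> nat \<Rightarrow> ('a, 'b) monoid_scheme"
  where "tower_group G T n = G\<lparr>carrier := topspace (T n)\<rparr>"

definition group_tower :: "('a, 'b) monoid_scheme \<Rightarrow> (nat \<Rightarrow> 'a topology) \<Rightarrow> bool" where
  "group_tower G T \<longleftrightarrow>
     group G \<and> carrier G = (\<Union>n. topspace (T n)) \<and>
     (\<forall>n. subgroup (topspace (T n)) G \<and>
          topological_group (tower_group G T n) (T n) \<and>
          subgroup (topspace (T n)) (tower_group G T (Suc n)) \<and>
          T n = subtopology (T (Suc n)) (topspace (T n)))"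

definition balanced_tower :: "('a, 'b) monoid_scheme \<Rightarrow> (nat \<Rightarrow> 'a topology) \<Rightarrow> bool" where
  "balanced_tower G T \<longleftrightarrow>
     group_tower G T \<and>
     (\<forall>n. balanced_triple (tower_group G T (n + 2)) (T (n + 2)) (T (n + 1)) (topspace (T n)))"

definition admissible :: "('a, 'b) monoid_scheme \<Rightarrow> (nat \<Rightarrow> 'a topology) \<Rightarrow> 'a topology \<Rightarrow> bool" where
  "admissible G T S \<longleftrightarrow> topological_group G S \<and> (\<forall>n. continuous_map (T n) S id)"

(* The description is well defined by the lemma strongest_admissible_ex1 below. *)
definition glim :: "('a, 'b) monoid_scheme \<Rightarrow> (nat \<Rightarrow> 'a topology) \<Rightarrow> 'a topology" where
  "glim G T =
     (THE S. admissible G T S \<and> (\<forall>S'. admissible G T S' \<longrightarrow> (\<forall>U. openin S' U \<longrightarrow> openin S U)))"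

lemma strongest_admissible_ex1:
  assumes "group_tower G T"
  shows "\<exists>!S. admissible G T S \<and> (\<forall>S'. admissible G T S' \<longrightarrow> (\<forall>U. openin S' U \<longrightarrow> openin S U))"
proof (rule ex_ex1I)
  define \<S> where "\<S> = insert (carrier G) {U. \<exists>S. admissible G T S \<and> openin S U}"
  define L where "L = topology_generated_by \<S>"
  have grp: "group G"
    using assms by (simp add: group_tower_def)
  have \<S>_cases: "U = carrier G \<or> (\<exists>S. admissible G T S \<and> openin S U)" if "U \<in> \<S>" for U
    using that by (auto simp: \<S>_def)
  have ts: "topspace S = carrier G" if "admissible G T S" for S
    using that by (simp add: admissible_def topological_group_def)
  have un: "\<Union>\<S> = carrier G"
  proof
    show "\<Union>\<S> \<subseteq> carrier G"
    proof (rule Sup_least)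
      fix U assume "U \<in> \<S>"
      then consider "U = carrier G" | S where "admissible G T S" "openin S U"
        using \<S>_cases by blast
      then show "U \<subseteq> carrier G"
      proof cases
        case 2
        then show ?thesis
          using openin_subset[OF 2(2)] ts[OF 2(1)] by simp
      qed simp
    qed
    show "carrier G \<subseteq> \<Union>\<S>"
      by (simp add: \<S>_def)
  qed
  then have topL: "topspace L = carrier G"
    by (simp add: L_def)
  have LS: "openin L U" if "admissible G T S" "openin S U" for S U
    unfolding L_def by (rule topology_generated_by_Basis) (use that in \<open>auto simp: \<S>_def\<close>)
  have idL: "continuous_map L S id" if "admissible G T S" for S
    unfolding continuous_map_def
  proof (intro conjI allI impI)
    show "id \<in> topspace L \<rightarrow> topspace S"
      using ts[OF that] topL by simp
    fix U assume U: "openin S U"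
    then have "{x \<in> topspace L. id x \<in> U} = U"
      using openin_subset[OF U] ts[OF that] topL by auto
    then show "openin L {x \<in> topspace L. id x \<in> U}"
      using LS[OF that U] by simp
  qed
  have into_L: "continuous_map X L f"
    if f: "f ` topspace X \<subseteq> carrier G"
      and c: "\<And>S. admissible G T S \<Longrightarrow> continuous_map X S f" for X :: "'x topology" and f
    unfolding L_def continuous_on_generated_topo_iff un
  proof (intro conjI allI impI)
    fix U assume "U \<in> \<S>"
    then consider "U = carrier G" | S where "admissible G T S" "openin S U"
      using \<S>_cases by blast
    then show "openin X (f -` U \<inter> topspace X)"
    proof cases
      case 1
      then have "f -` U \<inter> topspace X = topspace X"
        using f by auto
      then show ?thesis by simp
    next
      case 2
      have "f -` U \<inter> topspace X = {x \<in> topspace X. f x \<in> U}" by auto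
      then show ?thesis
        using openin_continuous_map_preimage[OF c[OF 2(1)] 2(2)] by simp
    qed
  qed (use f in auto)
  have "admissible G T L"
    unfolding admissible_def topological_group_def
  proof (intro conjI allI)
    show "continuous_map (prod_topology L L) L (\<lambda>(x, y). x \<otimes>\<^bsub>G\<^esub> y)"
    proof (rule into_L)
      show "(\<lambda>(x, y). x \<otimes>\<^bsub>G\<^esub> y) ` topspace (prod_topology L L) \<subseteq> carrier G"
        using monoid.m_closed[OF group.is_monoid[OF grp]] by (simp add: topL image_subset_iff)
    next
      fix S assume S: "admissible G T S"
      have "continuous_map (prod_topology L L) (prod_topology S S) (\<lambda>z. ((id \<circ> fst) z, (id \<circ> snd) z))"
        by (intro continuous_map_pairedI continuous_map_compose[OF _ idL[OF S]]
            continuous_map_fst continuous_map_snd)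
      moreover have "continuous_map (prod_topology S S) S (\<lambda>(x, y). x \<otimes>\<^bsub>G\<^esub> y)"
        using S by (simp add: admissible_def topological_group_def)
      ultimately have "continuous_map (prod_topology L L) S
          ((\<lambda>(x, y). x \<otimes>\<^bsub>G\<^esub> y) \<circ> (\<lambda>z. ((id \<circ> fst) z, (id \<circ> snd) z)))"
        by (rule continuous_map_compose)
      then show "continuous_map (prod_topology L L) S (\<lambda>(x, y). x \<otimes>\<^bsub>G\<^esub> y)"
        by (simp add: o_def case_prod_unfold)
    qed
    show "continuous_map L L (\<lambda>x. inv\<^bsub>G\<^esub> x)"
    proof (rule into_L)
      show "(\<lambda>x. inv\<^bsub>G\<^esub> x) ` topspace L \<subseteq> carrier G"
        using group.inv_closed[OF grp] by (simp add: topL image_subset_iff)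
    next
      fix S assume S: "admissible G T S"
      then have "continuous_map S S (\<lambda>x. inv\<^bsub>G\<^esub> x)"
        by (simp add: admissible_def topological_group_def)
      from continuous_map_compose[OF idL[OF S] this]
      show "continuous_map L S (\<lambda>x. inv\<^bsub>G\<^esub> x)" by (simp add: o_def)
    qed
    show "continuous_map (T n) L id" for n
    proof (rule into_L)
      show "id ` topspace (T n) \<subseteq> carrier G"
        using subgroup.subset[of "topspace (T n)" G] assms by (simp add: group_tower_def)
    qed (simp add: admissible_def)
  qed (fact grp topL)+
  then show "\<exists>S. admissible G T S \<and> (\<forall>S'. admissible G T S' \<longrightarrow> (\<forall>U. openin S' U \<longrightarrow> openin S U))"
    using LS by blast
next
  fix S S'
  assume "admissible G T S \<and> (\<forall>S'. admissible G T S' \<longrightarrow> (\<forall>U. openin S' U \<longrightarrow> openin S U))"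
    and "admissible G T S' \<and> (\<forall>S. admissible G T S \<longrightarrow> (\<forall>U. openin S U \<longrightarrow> openin S' U))"
  then have "openin S U \<longleftrightarrow> openin S' U" for U
    by blast
  then show "S = S'"
    by (simp only: topology_eq simp_thms)
qed

definition identity_base :: "('a, 'b) monoid_scheme \<Rightarrow> 'a topology \<Rightarrow> 'a set set \<Rightarrow> bool" where
  "identity_base G T \<B> \<longleftrightarrow>
     (\<forall>U\<in>\<B>. openin T U \<and> \<one>\<^bsub>G\<^esub> \<in> U \<and> set_inv\<^bsub>G\<^esub> U = U) \<and>
     neighbourhood_base_at \<one>\<^bsub>G\<^esub> (\<lambda>U. U \<in> \<B>) T"

primrec fin_rprod :: "('a, 'b) monoid_scheme \<Rightarrow> (nat \<Rightarrow> 'a set) \<Rightarrow> nat \<Rightarrow> 'a set" where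
  "fin_rprod G U 0 = U 0"
| "fin_rprod G U (Suc m) = fin_rprod G U m <#>\<^bsub>G\<^esub> U (Suc m)"

primrec fin_lprod :: "('a, 'b) monoid_scheme \<Rightarrow> (nat \<Rightarrow> 'a set) \<Rightarrow> nat \<Rightarrow> 'a set" where
  "fin_lprod G U 0 = U 0"
| "fin_lprod G U (Suc m) = U (Suc m) <#>\<^bsub>G\<^esub> fin_lprod G U m"

definition rprod :: "('a, 'b) monoid_scheme \<Rightarrow> (nat \<Rightarrow> 'a set) \<Rightarrow> 'a set" where
  "rprod G U = (\<Union>m. fin_rprod G U m)"

definition lprod :: "('a, 'b) monoid_scheme \<Rightarrow> (nat \<Rightarrow> 'a set) \<Rightarrow> 'a set" where
  "lprod G U = (\<Union>m. fin_lprod G U m)"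

definition lrprod :: "('a, 'b) monoid_scheme \<Rightarrow> (nat \<Rightarrow> 'a set) \<Rightarrow> 'a set" where
  "lrprod G U = (\<Union>m. fin_lprod G U m <#>\<^bsub>G\<^esub> fin_rprod G U m)"

(* As with mtopology in the library, this is the topology with base \<C> only if \<C> is a base of some
   topology. This holds in all four uses below, for every tower. *)
definition base_topology :: "'a set set \<Rightarrow> 'a topology" where
  "base_topology \<C> = topology (arbitrary union_of (\<lambda>S. S \<in> \<C>))"

definition right_topology :: "('a, 'b) monoid_scheme \<Rightarrow> (nat \<Rightarrow> 'a set set) \<Rightarrow> 'a topology" where
  "right_topology G \<B> =
     base_topology {rprod G U #>\<^bsub>G\<^esub> x | U x. (\<forall>n. U n \<in> \<B> n) \<and> x \<in> carrier G}"

definition left_topology :: "('a, 'b) monoid_scheme \<Rightarrow> (nat \<Rightarrow> 'a set set) \<Rightarrow> 'a topology" where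
  "left_topology G \<B> =
     base_topology {x <#\<^bsub>G\<^esub> lprod G U | U x. (\<forall>n. U n \<in> \<B> n) \<and> x \<in> carrier G}"

(* The topology written with the two-headed arrow. *)
definition twosided_topology :: "('a, 'b) monoid_scheme \<Rightarrow> (nat \<Rightarrow> 'a set set) \<Rightarrow> 'a topology" where
  "twosided_topology G \<B> =
     base_topology {(x <#\<^bsub>G\<^esub> lrprod G U) #>\<^bsub>G\<^esub> y | U x y.
        (\<forall>n. U n \<in> \<B> n) \<and> x \<in> carrier G \<and> y \<in> carrier G}"

(* The topology written with the pair of opposite harpoons. *)
definition meet_topology :: "('a, 'b) monoid_scheme \<Rightarrow> (nat \<Rightarrow> 'a set set) \<Rightarrow> 'a topology" where
  "meet_topology G \<B> =
     base_topology {(x <#\<^bsub>G\<^esub> lprod G U) \<inter> (rprod G U #>\<^bsub>G\<^esub> y) | U x y.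
        (\<forall>n. U n \<in> \<B> n) \<and> x \<in> carrier G \<and> y \<in> carrier G}"

end

theory Submission
  imports Defs
begin

text \<open>
  In every tower the sets \<open>rprod G U\<close> are open for translations, so they generate a group topology as
  soon as each of them contains some \<open>rprod G V <#> rprod G V\<close> and some \<open>set_inv (rprod G V)\<close>, which is
  \<open>lprod G V\<close> because the members of the bases are symmetric. Balancedness provides neighborhoods
  \<open>P\<^sub>n\<close> in \<open>G\<^sub>n\<close> such that an element of \<open>P\<^sub>n\<^sub>+\<^sub>1 P\<^sub>n\<^sub>+\<^sub>1\<close> factors as \<open>p q\<close> with \<open>p\<close> in \<open>P\<^sub>n\<close> and all conjugates
  of \<open>q\<close> by elements of \<open>G\<^sub>n\<^sub>-\<^sub>1\<close> small. In a product that has to be reordered, the factor \<open>q\<close> with the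
  largest index is moved to the right across everything that lies in \<open>G\<^sub>n\<^sub>-\<^sub>1\<close>, while \<open>p\<close> is absorbed
  one level lower; induction on the number of factors gives both inclusions. A standard halving
  argument shows that every group topology for which the inclusions are continuous is weaker than
  the resulting one, and the four families of sets are bases of it.
\<close>

section \<open>Translations, inversion and halving in a topological group\<close>

lemma topological_group_continuous_mult2:
  fixes K (structure)
  assumes tg: "topological_group K S"
    and f: "continuous_map X S f" and g: "continuous_map X S g"
  shows "continuous_map X S (\<lambda>x. f x \<otimes> g x)"
proof -
  have "continuous_map X (prod_topology S S) (\<lambda>x. (f x, g x))"
    using f g by (simp add: continuous_map_pairedI)
  moreover have "continuous_map (prod_topology S S) S (\<lambda>(x, y). x \<otimes> y)"
    using tg by (simp add: topological_group_def)
  ultimately have "continuous_map X S ((\<lambda>(x, y). x \<otimes> y) \<circ> (\<lambda>x. (f x, g x)))"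
    by (rule continuous_map_compose)
  then show ?thesis by (simp add: o_def)
qed

lemma topological_group_continuous_translation:
  fixes K (structure)
  assumes tg: "topological_group K S" and "c \<in> carrier K" "d \<in> carrier K"
  shows "continuous_map S S (\<lambda>x. c \<otimes> x \<otimes> d)"
proof -
  have "topspace S = carrier K" using tg by (simp add: topological_group_def)
  then show ?thesis
    using assms by (intro topological_group_continuous_mult2[OF tg]) auto
qed

lemma topological_group_openin_translation:
  fixes K (structure)
  assumes tg: "topological_group K S" and "c \<in> carrier K" "d \<in> carrier K" "openin S W"
  shows "openin S {x \<in> carrier K. c \<otimes> x \<otimes> d \<in> W}"
proof -
  have "topspace S = carrier K" using tg by (simp add: topological_group_def)
  then show ?thesis
    using openin_continuous_map_preimage[OF topological_group_continuous_translation[OF assms(1-3)] assms(4)]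
    by simp
qed

lemma topological_group_openin_l_coset:
  fixes K (structure)
  assumes tg: "topological_group K S" and x: "x \<in> carrier K" and W: "openin S W"
  shows "openin S (x <# W)"
proof -
  interpret group K using tg by (simp add: topological_group_def)
  have W_sub: "W \<subseteq> carrier K" using openin_subset[OF W] tg by (simp add: topological_group_def)
  have eq: "x <# W = {y \<in> carrier K. inv x \<otimes> y \<otimes> \<one> \<in> W}"
  proof (intro equalityI subsetI)
    fix y assume "y \<in> x <# W"
    then obtain w where "w \<in> W" "y = x \<otimes> w" by (auto simp: l_coset_def)
    then show "y \<in> {y \<in> carrier K. inv x \<otimes> y \<otimes> \<one> \<in> W}"
      using W_sub x by (auto simp: m_assoc[symmetric])
  next
    fix y assume "y \<in> {y \<in> carrier K. inv x \<otimes> y \<otimes> \<one> \<in> W}"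
    then have "inv x \<otimes> y \<in> W" "y = x \<otimes> (inv x \<otimes> y)"
      using x by (auto simp: m_assoc[symmetric])
    then show "y \<in> x <# W" unfolding l_coset_def by blast
  qed
  show ?thesis
    unfolding eq using topological_group_openin_translation[OF tg _ _ W, of "inv x" \<one>] x by simp
qed

lemma topological_group_openin_r_coset:
  fixes K (structure)
  assumes tg: "topological_group K S" and x: "x \<in> carrier K" and W: "openin S W"
  shows "openin S (W #> x)"
proof -
  interpret group K using tg by (simp add: topological_group_def)
  have W_sub: "W \<subseteq> carrier K" using openin_subset[OF W] tg by (simp add: topological_group_def)
  have eq: "W #> x = {y \<in> carrier K. \<one> \<otimes> y \<otimes> inv x \<in> W}"
  proof (intro equalityI subsetI)
    fix y assume "y \<in> W #> x"
    then obtain w where "w \<in> W" "y = w \<otimes> x" by (auto simp: r_coset_def)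
    then show "y \<in> {y \<in> carrier K. \<one> \<otimes> y \<otimes> inv x \<in> W}"
      using W_sub x by (auto simp: m_assoc)
  next
    fix y assume "y \<in> {y \<in> carrier K. \<one> \<otimes> y \<otimes> inv x \<in> W}"
    then have "y \<otimes> inv x \<in> W" "y = (y \<otimes> inv x) \<otimes> x"
      using x by (auto simp: m_assoc)
    then show "y \<in> W #> x" unfolding r_coset_def by blast
  qed
  show ?thesis
    unfolding eq using topological_group_openin_translation[OF tg _ _ W, of \<one> "inv x"] x by simp
qed

lemma topological_group_openin_set_mult:
  fixes K (structure)
  assumes tg: "topological_group K S" and A: "A \<subseteq> carrier K" and W: "openin S W"
  shows "openin S (A <#> W)"
proof -
  have "A <#> W = (\<Union>x\<in>A. x <# W)" by (simp add: set_mult_def l_coset_def)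
  then show ?thesis
    using topological_group_openin_l_coset[OF tg _ W] A by (auto intro!: openin_Union)
qed

lemma topological_group_openin_set_inv:
  fixes K (structure)
  assumes tg: "topological_group K S" and W: "openin S W"
  shows "openin S (set_inv W)"
proof -
  interpret group K using tg by (simp add: topological_group_def)
  have top: "topspace S = carrier K" using tg by (simp add: topological_group_def)
  have W_sub: "W \<subseteq> carrier K" using openin_subset[OF W] top by simp
  have "set_inv W = {y \<in> topspace S. inv y \<in> W}"
  proof (intro equalityI subsetI)
    fix y assume "y \<in> set_inv W"
    then show "y \<in> {y \<in> topspace S. inv y \<in> W}"
      using W_sub by (auto simp: SET_INV_def top)
  next
    fix y assume "y \<in> {y \<in> topspace S. inv y \<in> W}"
    then have "inv y \<in> W" "y = inv (inv y)" by (simp_all add: top)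
    then show "y \<in> set_inv W" unfolding SET_INV_def by blast
  qed
  then show ?thesis
    using openin_continuous_map_preimage[OF _ W, of S "\<lambda>x. inv x"] tg
    by (simp add: topological_group_def)
qed

lemma topological_group_half:
  fixes K (structure)
  assumes tg: "topological_group K S" and W: "openin S W" "\<one> \<in> W"
  obtains V where "openin S V" "\<one> \<in> V" "V <#> V \<subseteq> W"
proof -
  interpret group K using tg by (simp add: topological_group_def)
  have top: "topspace S = carrier K" using tg by (simp add: topological_group_def)
  have "openin (prod_topology S S) {z \<in> topspace (prod_topology S S). (\<lambda>(x, y). x \<otimes> y) z \<in> W}"
    using tg W(1) by (intro openin_continuous_map_preimage) (auto simp: topological_group_def)
  moreover have "(\<one>, \<one>) \<in> {z \<in> topspace (prod_topology S S). (\<lambda>(x, y). x \<otimes> y) z \<in> W}"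
    using W(2) top by simp
  ultimately obtain A B where AB: "openin S A" "openin S B" "\<one> \<in> A" "\<one> \<in> B"
     "A \<times> B \<subseteq> {z \<in> topspace (prod_topology S S). (\<lambda>(x, y). x \<otimes> y) z \<in> W}"
    unfolding openin_prod_topology_alt by meson
  show ?thesis
  proof
    show "openin S (A \<inter> B)" using AB by auto
    show "\<one> \<in> A \<inter> B" using AB by simp
    show "(A \<inter> B) <#> (A \<inter> B) \<subseteq> W" using AB(5) by (auto simp: set_mult_def)
  qed
qed

section \<open>Ordered products of sets\<close>

lemma fin_rprod_mono:
  "(\<And>i. i \<le> m \<Longrightarrow> U i \<subseteq> V i) \<Longrightarrow> fin_rprod G U m \<subseteq> fin_rprod G V m"
  by (induction m) (auto simp: mono_set_mult)

lemma fin_lprod_mono: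
  "(\<And>i. i \<le> m \<Longrightarrow> U i \<subseteq> V i) \<Longrightarrow> fin_lprod G U m \<subseteq> fin_lprod G V m"
  by (induction m) (auto simp: mono_set_mult)

lemma rprod_mono: "(\<And>i. U i \<subseteq> V i) \<Longrightarrow> rprod G U \<subseteq> rprod G V"
  unfolding rprod_def by (intro UN_mono fin_rprod_mono) auto

lemma lprod_mono: "(\<And>i. U i \<subseteq> V i) \<Longrightarrow> lprod G U \<subseteq> lprod G V"
  unfolding lprod_def by (intro UN_mono fin_lprod_mono) auto

text \<open>Each \<open>W (Suc n)\<close> has its square inside \<open>W n\<close>, so the room left
  after the last factor suffices for the next one. One sequence serves every \<open>m\<close>, which
  is what carries the bound over to infinite products.\<close>

lemma topological_group_small_products:
  fixes K (structure)
  assumes tg: "topological_group K S" and D: "openin S D" "\<one> \<in> D"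
  obtains W where "\<And>i::nat. openin S (W i)" "\<And>i. \<one> \<in> W i" "\<And>m. fin_rprod K W m \<subseteq> D"
proof -
  interpret group K using tg by (simp add: topological_group_def)
  have top: "topspace S = carrier K" using tg by (simp add: topological_group_def)
  \<comment> \<open>The conjunct guarded by \<open>n = 0\<close> ties the chain to \<open>D\<close>
    within the invariant of the dependent choice.\<close>
  have "\<exists>W. \<forall>n. (openin S (W n) \<and> \<one> \<in> W n \<and> (n = 0 \<longrightarrow> W n <#> W n \<subseteq> D)) \<and>
              W (Suc n) <#> W (Suc n) \<subseteq> W n"
  proof (rule dependent_nat_choice)
    show "\<exists>W. openin S W \<and> \<one> \<in> W \<and> ((0::nat) = 0 \<longrightarrow> W <#> W \<subseteq> D)"
      using topological_group_half[OF tg D] by metis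
    show "\<exists>V. (openin S V \<and> \<one> \<in> V \<and> (Suc n = 0 \<longrightarrow> V <#> V \<subseteq> D)) \<and> V <#> V \<subseteq> W"
      if "openin S W \<and> \<one> \<in> W \<and> (n = 0 \<longrightarrow> W <#> W \<subseteq> D)" for W and n :: nat
      using topological_group_half[OF tg, of W] that by (metis nat.distinct(2))
  qed
  then obtain W where W: "\<And>n. openin S (W n)" "\<And>n. \<one> \<in> W n" "W 0 <#> W 0 \<subseteq> D"
     "\<And>n. W (Suc n) <#> W (Suc n) \<subseteq> W n"
    by metis
  have sub: "W n \<subseteq> carrier K" for n using openin_subset[OF W(1)] top by simp
  have fin_sub: "fin_rprod K W m \<subseteq> carrier K" for m
    by (induction m) (simp_all add: sub set_mult_closed)
  \<comment> \<open>The duplicated last factor is the strengthening that makes the induction work: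
    \<open>W (Suc m) <#> W (Suc m)\<close> collapses into the spare \<open>W m\<close>.\<close>
  have claim: "fin_rprod K W m <#> W m \<subseteq> D" for m
  proof (induction m)
    case (Suc m)
    have "fin_rprod K W (Suc m) <#> W (Suc m) = fin_rprod K W m <#> (W (Suc m) <#> W (Suc m))"
      using sub fin_sub by (simp add: set_mult_assoc)
    also have "\<dots> \<subseteq> fin_rprod K W m <#> W m"
      using W(4) by (simp add: mono_set_mult)
    finally show ?case using Suc by blast
  qed (use W in simp)
  have "fin_rprod K W m \<subseteq> D" for m
  proof
    fix x assume x: "x \<in> fin_rprod K W m"
    then have "x \<otimes> \<one> \<in> fin_rprod K W m <#> W m"
      using W(2) unfolding set_mult_def by blast
    moreover have "x \<otimes> \<one> = x" using x fin_sub by (meson r_one subsetD)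
    ultimately show "x \<in> D" using claim by auto
  qed
  with W show ?thesis using that by blast
qed

text \<open>The classical construction of a group topology from a filter base at the identity, with
  right translates as neighborhoods. The condition \<open>trl\<close> serves twice: with
  \<open>c = \<one>\<close> it makes each \<open>U\<close> a neighborhood of all its points, and
  with \<open>d = inv c\<close> it bounds conjugates.\<close>

lemma topological_group_of_filter_base:
  fixes G (structure) and N :: "'a set set"
  assumes grp: "group G" and ne: "N \<noteq> {}"
    and sub: "\<And>U. U \<in> N \<Longrightarrow> U \<subseteq> carrier G" and one: "\<And>U. U \<in> N \<Longrightarrow> \<one> \<in> U"
    and int: "\<And>U V. U \<in> N \<Longrightarrow> V \<in> N \<Longrightarrow> \<exists>W\<in>N. W \<subseteq> U \<inter> V"
    and trl: "\<And>U c d. U \<in> N \<Longrightarrow> c \<in> carrier G \<Longrightarrow> d \<in> carrier G \<Longrightarrow> c \<otimes> d \<in> U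
                \<Longrightarrow> \<exists>V\<in>N. \<forall>x\<in>V. c \<otimes> x \<otimes> d \<in> U"
    and mul: "\<And>U. U \<in> N \<Longrightarrow> \<exists>V\<in>N. V <#> V \<subseteq> U"
    and inv: "\<And>U. U \<in> N \<Longrightarrow> \<exists>V\<in>N. set_inv V \<subseteq> U"
  shows "\<exists>S. topological_group G S \<and>
    (\<forall>D. openin S D \<longleftrightarrow> D \<subseteq> carrier G \<and> (\<forall>x\<in>D. \<exists>U\<in>N. U #> x \<subseteq> D)) \<and>
    (\<forall>U\<in>N. \<forall>x\<in>carrier G. openin S (U #> x))"
proof -
  interpret group G by fact
  define P where "P D \<longleftrightarrow> D \<subseteq> carrier G \<and> (\<forall>x\<in>D. \<exists>U\<in>N. U #> x \<subseteq> D)" for D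
  have r_mono: "A #> x \<subseteq> B #> x" if "A \<subseteq> B" for A B x
    using that by (auto simp: r_coset_def)
  have "istopology P"
    unfolding istopology_def
  proof (intro conjI allI impI)
    fix A B assume AB: "P A" "P B"
    show "P (A \<inter> B)"
      unfolding P_def
    proof (intro conjI ballI)
      show "A \<inter> B \<subseteq> carrier G" using AB by (auto simp: P_def)
      fix x assume "x \<in> A \<inter> B"
      then obtain U V where "U \<in> N" "V \<in> N" "U #> x \<subseteq> A" "V #> x \<subseteq> B"
        using AB unfolding P_def by blast
      moreover obtain W where "W \<in> N" "W \<subseteq> U \<inter> V" using int calculation by blast
      ultimately show "\<exists>W\<in>N. W #> x \<subseteq> A \<inter> B"
        using r_mono[of W U x] r_mono[of W V x] by blast
    qed
  next
    fix \<K> assume "\<forall>K\<in>\<K>. P K"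
    then show "P (\<Union>\<K>)" unfolding P_def by (meson Sup_least Union_iff Union_upper subset_trans)
  qed
  then have open_iff: "openin (topology P) D \<longleftrightarrow> P D" for D
    by (simp add: topology_inverse')
  have "P (carrier G)"
    using ne sub r_coset_subset_G by (auto simp: P_def)
  then have top: "topspace (topology P) = carrier G"
    unfolding topspace_def open_iff by (auto simp: P_def)
  have coset_open: "openin (topology P) (U #> x)" if U: "U \<in> N" and x: "x \<in> carrier G" for U x
    unfolding open_iff P_def
  proof (intro conjI ballI)
    show "U #> x \<subseteq> carrier G" using sub[OF U] x by (rule r_coset_subset_G)
    fix y assume "y \<in> U #> x"
    then obtain u where u: "u \<in> U" "y = u \<otimes> x" by (auto simp: r_coset_def)
    have uG: "u \<in> carrier G" using u sub U by blast
    obtain V where V: "V \<in> N" "\<forall>v\<in>V. \<one> \<otimes> v \<otimes> u \<in> U"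
      using trl[OF U, of \<one> u] u uG by auto
    have "V #> y \<subseteq> U #> x"
    proof
      fix z assume "z \<in> V #> y"
      then obtain v where v: "v \<in> V" "z = v \<otimes> y" by (auto simp: r_coset_def)
      then have "z = (v \<otimes> u) \<otimes> x" using sub[OF V(1)] uG u x by (auto simp: m_assoc)
      moreover have "v \<otimes> u \<in> U" using V v sub[OF V(1)] by (metis l_one subsetD)
      ultimately show "z \<in> U #> x" by (auto simp: r_coset_def)
    qed
    with V show "\<exists>V\<in>N. V #> y \<subseteq> U #> x" by blast
  qed
  have self: "x \<in> U #> x" if "U \<in> N" "x \<in> carrier G" for U x
    unfolding r_coset_def using one[OF that(1)] l_one[OF that(2)] by blast
  have "topological_group G (topology P)"
    unfolding topological_group_def
  proof (intro conjI)
    show "continuous_map (prod_topology (topology P) (topology P)) (topology P) (\<lambda>(x, y). x \<otimes> y)"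
      unfolding continuous_map_def
    proof (intro conjI allI impI)
      fix D assume "openin (topology P) D"
      then have D: "P D" by (simp add: open_iff)
      show "openin (prod_topology (topology P) (topology P))
         {z \<in> topspace (prod_topology (topology P) (topology P)). (case z of (x, y) \<Rightarrow> x \<otimes> y) \<in> D}"
        unfolding openin_prod_topology_alt
      proof (intro allI impI)
        fix x y
        assume "(x, y) \<in> {z \<in> topspace (prod_topology (topology P) (topology P)).
                          (case z of (x, y) \<Rightarrow> x \<otimes> y) \<in> D}"
        then have xy: "x \<in> carrier G" "y \<in> carrier G" "x \<otimes> y \<in> D" by (auto simp: top)
        obtain U where U: "U \<in> N" "U #> (x \<otimes> y) \<subseteq> D" using D xy by (auto simp: P_def)
        obtain V where V: "V \<in> N" "V <#> V \<subseteq> U" using mul U by blast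
        \<comment> \<open>Conjugation by \<open>x\<close> enters because
          \<open>(v x) (w y) = v (x w (inv x)) (x y)\<close>.\<close>
        obtain W where W: "W \<in> N" "\<forall>w\<in>W. x \<otimes> w \<otimes> inv x \<in> V"
          using trl[OF V(1), of x "inv x"] one[OF V(1)] xy by auto
        have "a \<otimes> b \<in> D" if ab: "a \<in> V #> x" "b \<in> W #> y" for a b
        proof -
          obtain v w where v: "v \<in> V" "a = v \<otimes> x" and w: "w \<in> W" "b = w \<otimes> y"
            using ab by (auto simp: r_coset_def)
          have vw: "v \<in> carrier G" "w \<in> carrier G" using v w sub V W by blast+
          have "v \<otimes> (x \<otimes> w \<otimes> inv x) \<in> U" using v w V W by (auto simp: set_mult_def)
          then have "(v \<otimes> (x \<otimes> w \<otimes> inv x)) \<otimes> (x \<otimes> y) \<in> D"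
            using U by (auto simp: r_coset_def)
          moreover have inv_cancel: "inv x \<otimes> (x \<otimes> y) = y"
            using xy by (simp add: m_assoc[symmetric])
          moreover have "(v \<otimes> (x \<otimes> w \<otimes> inv x)) \<otimes> (x \<otimes> y) = a \<otimes> b"
            using vw v w xy by (simp add: m_assoc inv_cancel)
          ultimately show ?thesis by simp
        qed
        moreover have "V #> x \<subseteq> carrier G" "W #> y \<subseteq> carrier G"
          using r_coset_subset_G sub V W xy by auto
        ultimately show "\<exists>A B. openin (topology P) A \<and> openin (topology P) B \<and> x \<in> A \<and> y \<in> B \<and>
           A \<times> B \<subseteq> {z \<in> topspace (prod_topology (topology P) (topology P)).
                       (case z of (x, y) \<Rightarrow> x \<otimes> y) \<in> D}"
          using coset_open[OF V(1) xy(1)] coset_open[OF W(1) xy(2)] self[OF V(1) xy(1)]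
            self[OF W(1) xy(2)]
          by (intro exI[of _ "V #> x"] exI[of _ "W #> y"]) (auto simp: top)
      qed
    qed (auto simp: top)
    show "continuous_map (topology P) (topology P) (\<lambda>x. inv x)"
      unfolding continuous_map_def
    proof (intro conjI allI impI)
      fix D assume "openin (topology P) D"
      then have D: "P D" by (simp add: open_iff)
      show "openin (topology P) {x \<in> topspace (topology P). inv x \<in> D}"
        unfolding top open_iff P_def
      proof (intro conjI ballI)
        fix x assume "x \<in> {x \<in> carrier G. inv x \<in> D}"
        then have x: "x \<in> carrier G" "inv x \<in> D" by auto
        obtain U where U: "U \<in> N" "U #> inv x \<subseteq> D" using D x by (auto simp: P_def)
        \<comment> \<open>Prepared for \<open>inv (v x) = (inv x (inv v) x) (inv x)\<close>, which
          turns a right translate by \<open>x\<close> into one by \<open>inv x\<close>.\<close>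
        obtain W where W: "W \<in> N" "\<forall>w\<in>W. inv x \<otimes> w \<otimes> x \<in> U"
          using trl[OF U(1), of "inv x" x] one[OF U(1)] x by auto
        obtain V where V: "V \<in> N" "set_inv V \<subseteq> W" using inv W by blast
        have "inv (v \<otimes> x) \<in> D" if v: "v \<in> V" for v
        proof -
          have vG: "v \<in> carrier G" using v sub V by blast
          have "inv v \<in> W" using v V by (auto simp: SET_INV_def)
          then have "(inv x \<otimes> inv v \<otimes> x) \<otimes> inv x \<in> D"
            using W U by (auto simp: r_coset_def)
          then show ?thesis using vG x by (simp add: m_assoc inv_mult_group)
        qed
        moreover have "V #> x \<subseteq> carrier G" using r_coset_subset_G sub V x by auto
        ultimately have "V #> x \<subseteq> {x \<in> carrier G. inv x \<in> D}"
          by (auto simp: r_coset_def)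
        with V show "\<exists>V\<in>N. V #> x \<subseteq> {x \<in> carrier G. inv x \<in> D}" by blast
      qed (auto simp: top)
    qed (auto simp: top)
  qed (fact grp top)+
  then show ?thesis
    using open_iff coset_open unfolding P_def by blast
qed

lemma base_topology_eqI:
  assumes "\<And>C. C \<in> \<C> \<Longrightarrow> openin S C"
    and "\<And>D x. openin S D \<Longrightarrow> x \<in> D \<Longrightarrow> \<exists>C\<in>\<C>. x \<in> C \<and> C \<subseteq> D"
  shows "base_topology \<C> = S"
  unfolding base_topology_def
  by (rule topology_base_unique) (use assms in blast)+

section \<open>Products of neighborhoods in a tower\<close>

locale based_tower =
  fixes G :: "('a, 'b) monoid_scheme" (structure) and T :: "nat \<Rightarrow> 'a topology"
    and \<B> :: "nat \<Rightarrow> 'a set set"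
  assumes tower: "group_tower G T"
    and base: "\<And>n. identity_base (tower_group G T n) (T n) (\<B> n)"
begin

sublocale group G
  using tower by (simp add: group_tower_def)

abbreviation grp :: "nat \<Rightarrow> 'a set" where "grp n \<equiv> topspace (T n)"

abbreviation "base_seq U \<equiv> \<forall>n. U n \<in> \<B> n"

lemma carrier_eq: "carrier G = (\<Union>n. grp n)"
  using tower by (simp add: group_tower_def)

lemma subgroup_grp: "subgroup (grp n) G"
  using tower by (simp add: group_tower_def)

lemmas grp_mult [simp] = subgroup.m_closed[OF subgroup_grp]
lemmas grp_inv [simp] = subgroup.m_inv_closed[OF subgroup_grp]
lemmas grp_one [simp] = subgroup.one_closed[OF subgroup_grp]

lemma grp_carrier: "x \<in> grp n \<Longrightarrow> x \<in> carrier G"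
  using carrier_eq by blast

lemma topological_group_grp: "topological_group (tower_group G T n) (T n)"
  using tower by (simp add: group_tower_def)

lemma tower_group_simps [simp]:
  "carrier (tower_group G T n) = grp n"
  "x \<otimes>\<^bsub>tower_group G T n\<^esub> y = x \<otimes> y"
  "\<one>\<^bsub>tower_group G T n\<^esub> = \<one>"
  "A <#>\<^bsub>tower_group G T n\<^esub> B = A <#> B"
  "A #>\<^bsub>tower_group G T n\<^esub> x = A #> x"
  by (simp_all add: tower_group_def set_mult_def r_coset_def)

lemma tower_group_inv: "x \<in> grp n \<Longrightarrow> inv\<^bsub>tower_group G T n\<^esub> x = inv x"
  unfolding tower_group_def by (rule m_inv_consistent[OF subgroup_grp])

lemma fin_rprod_tower_group [simp]: "fin_rprod (tower_group G T n) U m = fin_rprod G U m"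
  by (induction m) simp_all

lemma T_Suc: "T n = subtopology (T (Suc n)) (grp n)"
  using tower by (simp add: group_tower_def)

lemma grp_Suc: "grp n \<subseteq> grp (Suc n)"
  by (metis T_Suc inf.cobounded1 topspace_subtopology)

lemma grp_mono: "m \<le> n \<Longrightarrow> grp m \<subseteq> grp n"
  by (rule lift_Suc_mono_le[of grp]) (rule grp_Suc)

lemma continuous_map_grp: "m \<le> n \<Longrightarrow> continuous_map (T m) (T n) id"
proof (induction n rule: dec_induct)
  case (step n)
  have "continuous_map (T n) (T (Suc n)) id"
    by (subst T_Suc) (simp add: continuous_map_from_subtopology)
  from continuous_map_compose[OF step.IH this] show ?case by simp
qed simp

lemma ex_grp2:
  assumes "x \<in> carrier G" "y \<in> carrier G"
  obtains n where "x \<in> grp n" "y \<in> grp n"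
proof -
  obtain i j where "x \<in> grp i" "y \<in> grp j" using assms carrier_eq by blast
  then show ?thesis
    using that[of "max i j"] grp_mono[of i "max i j"] grp_mono[of j "max i j"] by auto
qed

lemma
  assumes "U \<in> \<B> n"
  shows base_open: "openin (T n) U" and base_one: "\<one> \<in> U"
    and base_grp: "U \<subseteq> grp n" and base_inv: "x \<in> U \<Longrightarrow> inv x \<in> U"
proof -
  have U: "openin (T n) U" "\<one> \<in> U" "set_inv\<^bsub>tower_group G T n\<^esub> U = U"
    using base[of n] assms by (auto simp: identity_base_def)
  then show "openin (T n) U" "\<one> \<in> U" by auto
  show sub: "U \<subseteq> grp n" using openin_subset[OF U(1)] .
  show "inv x \<in> U" if "x \<in> U"
  proof -
    have "inv\<^bsub>tower_group G T n\<^esub> x \<in> set_inv\<^bsub>tower_group G T n\<^esub> U"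
      using that unfolding SET_INV_def by blast
    then show ?thesis using U(3) tower_group_inv that sub by auto
  qed
qed

lemma base_set_inv:
  assumes U: "U \<in> \<B> n"
  shows "set_inv U = U"
proof
  show "set_inv U \<subseteq> U" using base_inv[OF U] by (auto simp: SET_INV_def)
  show "U \<subseteq> set_inv U"
  proof
    fix x assume x: "x \<in> U"
    then have "x = inv (inv x)" using base_grp[OF U] grp_carrier by (metis inv_inv subsetD)
    then show "x \<in> set_inv U" using base_inv[OF U x] unfolding SET_INV_def by blast
  qed
qed

lemma base_carrier: "U \<in> \<B> n \<Longrightarrow> U \<subseteq> carrier G"
  using base_grp grp_carrier by blast

lemma base_exists:
  assumes "openin (T n) W" "\<one> \<in> W"
  obtains U where "U \<in> \<B> n" "U \<subseteq> W"
  using base[of n] assms by (auto simp: identity_base_def neighbourhood_base_at_def)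

lemma base_seq_exists:
  assumes "\<And>i. openin (T i) (W i)" "\<And>i. \<one> \<in> W i"
  obtains U where "base_seq U" "\<And>i. U i \<subseteq> W i"
proof -
  have "\<forall>i. \<exists>U. U \<in> \<B> i \<and> U \<subseteq> W i" using base_exists assms by metis
  then show ?thesis using that by metis
qed

lemma base_seq_inter:
  assumes "base_seq U" "base_seq V"
  obtains W where "base_seq W" "\<And>i. W i \<subseteq> U i" "\<And>i. W i \<subseteq> V i"
proof (rule base_seq_exists[of "\<lambda>i. U i \<inter> V i"])
  show "openin (T i) (U i \<inter> V i)" for i
    using assms base_open by blast
  show "\<one> \<in> U i \<inter> V i" for i
    using assms base_one by blast
qed (use that in auto)

lemma fin_rprod_Suc_I: "x \<in> fin_rprod G U m \<Longrightarrow> u \<in> U (Suc m) \<Longrightarrow> x \<otimes> u \<in> fin_rprod G U (Suc m)"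
  by (auto simp: set_mult_def)

lemma fin_lprod_Suc_I: "x \<in> fin_lprod G U m \<Longrightarrow> u \<in> U (Suc m) \<Longrightarrow> u \<otimes> x \<in> fin_lprod G U (Suc m)"
  by (auto simp: set_mult_def)

context
  fixes U assumes U: "base_seq U"
begin

lemma fin_rprod_grp: "fin_rprod G U m \<subseteq> grp m"
proof (induction m)
  case (Suc m)
  then show ?case using grp_Suc[of m] base_grp U by (fastforce simp: set_mult_def)
qed (use base_grp U in simp)

lemma fin_lprod_grp: "fin_lprod G U m \<subseteq> grp m"
proof (induction m)
  case (Suc m)
  then show ?case using grp_Suc[of m] base_grp U by (fastforce simp: set_mult_def)
qed (use base_grp U in simp)

lemma fin_rprod_Suc_mono: "fin_rprod G U m \<subseteq> fin_rprod G U (Suc m)"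
proof
  fix x assume x: "x \<in> fin_rprod G U m"
  then have "x \<in> carrier G" using fin_rprod_grp grp_carrier by blast
  then show "x \<in> fin_rprod G U (Suc m)"
    using fin_rprod_Suc_I[where U = U, OF x, of \<one>] base_one U by auto
qed

lemma fin_lprod_Suc_mono: "fin_lprod G U m \<subseteq> fin_lprod G U (Suc m)"
proof
  fix x assume x: "x \<in> fin_lprod G U m"
  then have "x \<in> carrier G" using fin_lprod_grp grp_carrier by blast
  then show "x \<in> fin_lprod G U (Suc m)"
    using fin_lprod_Suc_I[where U = U, OF x, of \<one>] base_one U by auto
qed

lemma fin_rprod_le: "m \<le> n \<Longrightarrow> fin_rprod G U m \<subseteq> fin_rprod G U n"
  by (rule lift_Suc_mono_le[of "fin_rprod G U"]) (rule fin_rprod_Suc_mono)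

lemma fin_lprod_le: "m \<le> n \<Longrightarrow> fin_lprod G U m \<subseteq> fin_lprod G U n"
  by (rule lift_Suc_mono_le[of "fin_lprod G U"]) (rule fin_lprod_Suc_mono)

lemma fin_rprod_open: "openin (T m) (fin_rprod G U m)"
proof (cases m)
  case (Suc k)
  have "openin (T (Suc k)) (fin_rprod G U k <#>\<^bsub>tower_group G T (Suc k)\<^esub> U (Suc k))"
    using fin_rprod_grp[of k] grp_Suc[of k] base_open U
    by (intro topological_group_openin_set_mult[OF topological_group_grp]) auto
  then show ?thesis using Suc by simp
qed (use U base_open in simp)

lemma base_subset_fin_rprod: "U m \<subseteq> fin_rprod G U m"
proof (cases m)
  case (Suc k)
  have "\<one> \<in> fin_rprod G U k"
    using fin_rprod_le[of 0 k] base_one U by auto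
  then show ?thesis
    using Suc base_carrier U by (force simp: set_mult_def)
qed simp

lemma rprod_carrier: "rprod G U \<subseteq> carrier G"
  using fin_rprod_grp carrier_eq by (auto simp: rprod_def)

lemma lprod_carrier: "lprod G U \<subseteq> carrier G"
  using fin_lprod_grp carrier_eq by (auto simp: lprod_def)

lemma base_subset_rprod: "U m \<subseteq> rprod G U"
  using base_subset_fin_rprod by (auto simp: rprod_def)

lemma rprod_one: "\<one> \<in> rprod G U"
  using base_subset_rprod[of 0] base_one U by auto

text \<open>Inversion reverses the order of the factors, and each factor is symmetric. Facts about
  left products are thereby obtained from those about right products.\<close>

lemma set_inv_fin_rprod: "set_inv (fin_rprod G U m) = fin_lprod G U m"
proof (induction m)
  case 0
  show ?case by (simp add: base_set_inv[OF U[rule_format]])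
next
  case (Suc m)
  have "set_inv (fin_rprod G U m <#> U (Suc m)) = set_inv (U (Suc m)) <#> set_inv (fin_rprod G U m)"
  proof -
    have "inv (x \<otimes> u) = inv u \<otimes> inv x" if "x \<in> fin_rprod G U m" "u \<in> U (Suc m)" for x u
      using that fin_rprod_grp grp_carrier base_carrier U by (meson inv_mult_group subsetD)
    then show ?thesis unfolding SET_INV_def set_mult_def by force
  qed
  then show ?case by (simp add: Suc base_set_inv[OF U[rule_format]])
qed

lemma set_inv_rprod: "set_inv (rprod G U) = lprod G U"
  unfolding rprod_def lprod_def set_inv_fin_rprod[symmetric] by (auto simp: SET_INV_def)

lemma lprod_one: "\<one> \<in> lprod G U"
  using rprod_one by (force simp: set_inv_rprod[symmetric] SET_INV_def)

text \<open>Finite products grow with their length, so two separate lengths can be raised to their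
  maximum.\<close>

lemma lrprod_eq: "lrprod G U = lprod G U <#> rprod G U"
proof
  show "lrprod G U \<subseteq> lprod G U <#> rprod G U"
    by (auto simp: lrprod_def lprod_def rprod_def set_mult_def)
  show "lprod G U <#> rprod G U \<subseteq> lrprod G U"
  proof
    fix z assume "z \<in> lprod G U <#> rprod G U"
    then obtain x y i j where xy: "x \<in> fin_lprod G U i" "y \<in> fin_rprod G U j" "z = x \<otimes> y"
      by (auto simp: lprod_def rprod_def set_mult_def)
    then have "x \<in> fin_lprod G U (max i j)" "y \<in> fin_rprod G U (max i j)"
      using fin_lprod_le[of i "max i j"] fin_rprod_le[of j "max i j"] by auto
    then show "z \<in> lrprod G U" using xy(3) unfolding lrprod_def set_mult_def by blast
  qed
qed

end

text \<open>Halving is done inside the single group \<open>grp m\<close>, and the resulting sets are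
  pulled back to the lower groups. The family \<open>X\<close> lets further conditions be imposed on
  all levels at the same time.\<close>

lemma fin_rprod_small:
  assumes W: "openin (T m) W" "\<one> \<in> W"
    and X: "\<And>i. openin (T i) (X i)" "\<And>i. \<one> \<in> X i"
  obtains V where "base_seq V" "fin_rprod G V m \<subseteq> W" "\<And>i. V i \<subseteq> X i"
proof -
  from W(2) obtain W' where W': "\<And>i::nat. openin (T m) (W' i)" "\<And>i. \<one> \<in> W' i" "\<And>j. fin_rprod G W' j \<subseteq> W"
    by (rule topological_group_small_products[OF topological_group_grp W(1),
          unfolded tower_group_simps fin_rprod_tower_group]) blast
  \<comment> \<open>Levels above \<open>m\<close> do not enter \<open>fin_rprod G V m\<close>, hence
    the unrestricted value \<open>grp i\<close> there.\<close>
  define Y where "Y i = (if i \<le> m then {x \<in> grp i. id x \<in> W' i} else grp i)" for i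
  have "openin (T i) (Y i)" for i
    using openin_continuous_map_preimage[OF continuous_map_grp W'(1), of i] by (simp add: Y_def)
  moreover have "\<one> \<in> Y i" for i using W' by (simp add: Y_def)
  ultimately obtain V where V: "base_seq V" "\<And>i. V i \<subseteq> Y i \<inter> X i"
    using base_seq_exists[of "\<lambda>i. Y i \<inter> X i"] X by blast
  have "V i \<subseteq> W' i" if "i \<le> m" for i
    using V(2)[of i] that by (auto simp: Y_def)
  then have "fin_rprod G V m \<subseteq> fin_rprod G W' m"
    by (rule fin_rprod_mono)
  then have "fin_rprod G V m \<subseteq> W" using W'(3) by blast
  moreover have "V i \<subseteq> X i" for i using V(2) by blast
  ultimately show ?thesis by (rule that[OF V(1)])
qed

text \<open>The halving sequence is chosen in \<open>S\<close> and pulled back along the inclusions.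
  This is the source of the maximality of the limit topology among group topologies with continuous
  inclusions.\<close>

lemma rprod_small:
  assumes S: "topological_group G S" "\<And>n. continuous_map (T n) S id"
    and D: "openin S D" "\<one> \<in> D"
  obtains V where "base_seq V" "rprod G V \<subseteq> D"
proof -
  obtain W where W: "\<And>i::nat. openin S (W i)" "\<And>i. \<one> \<in> W i" "\<And>m. fin_rprod G W m \<subseteq> D"
    using topological_group_small_products[OF S(1) D] by blast
  have "openin (T i) {x \<in> grp i. id x \<in> W i}" for i
    using openin_continuous_map_preimage[OF S(2) W(1)] .
  then obtain V where V: "base_seq V" "\<And>i. V i \<subseteq> {x \<in> grp i. id x \<in> W i}"
    using base_seq_exists[of "\<lambda>i. {x \<in> grp i. id x \<in> W i}"] W by auto
  have "V i \<subseteq> W i" for i using V(2)[of i] by auto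
  then have "fin_rprod G V m \<subseteq> fin_rprod G W m" for m by (rule fin_rprod_mono)
  then have "rprod G V \<subseteq> D" using W(3) unfolding rprod_def by blast
  with V(1) show ?thesis by (rule that)
qed

text \<open>A product splits at a level \<open>m\<close> large enough for \<open>c\<close>,
  \<open>d\<close> and \<open>c \<otimes> d\<close>. The initial part is controlled by continuity of
  translations in \<open>grp m\<close>. Each later factor \<open>v\<close> is replaced by its
  conjugate, since \<open>c y v d = (c y d) (inv d v d)\<close>.\<close>

lemma rprod_translation:
  assumes U: "base_seq U" and c: "c \<in> carrier G" and d: "d \<in> carrier G"
    and cd: "c \<otimes> d \<in> rprod G U"
  obtains V where "base_seq V" "\<And>x. x \<in> rprod G V \<Longrightarrow> c \<otimes> x \<otimes> d \<in> rprod G U"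
proof -
  obtain n where n: "c \<in> grp n" "d \<in> grp n" using ex_grp2[OF c d] .
  obtain k where k: "c \<otimes> d \<in> fin_rprod G U k" using cd by (auto simp: rprod_def)
  define m where "m = max n k"
  have mem: "c \<in> grp i" "d \<in> grp i" if "m \<le> i" for i
    using n that grp_mono[of n i] by (auto simp: m_def)
  have k': "c \<otimes> d \<in> fin_rprod G U m"
    using k fin_rprod_le[OF U, of k m] by (auto simp: m_def)
  define W where "W = {x \<in> grp m. c \<otimes> x \<otimes> d \<in> fin_rprod G U m}"
  \<comment> \<open>Above \<open>m\<close> the element \<open>d\<close> lies in
    \<open>grp i\<close>, so conjugation by \<open>d\<close> is continuous there. Up to
    \<open>m\<close> the set \<open>W\<close> already takes care of the factors.\<close>
  define X where "X i = (if m < i then {x \<in> grp i. inv d \<otimes> x \<otimes> d \<in> U i} else grp i)" for i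
  have transl: "openin (T i) {x \<in> grp i. a \<otimes> x \<otimes> b \<in> A}"
    if "a \<in> grp i" "b \<in> grp i" "openin (T i) A" for a b i A
    using topological_group_openin_translation[OF topological_group_grp[of i], of a b A] that by simp
  have "openin (T m) W"
    unfolding W_def using mem by (intro transl fin_rprod_open U) auto
  moreover have "\<one> \<in> W" using k' c by (simp add: W_def)
  moreover have "openin (T i) (X i)" for i
    unfolding X_def using mem U base_open by (auto intro!: transl)
  moreover have "\<one> \<in> X i" for i
    using base_one U d by (auto simp: X_def)
  ultimately obtain V where V: "base_seq V" "fin_rprod G V m \<subseteq> W" "\<And>i. V i \<subseteq> X i"
    using fin_rprod_small[of m W X] by blast
  have *: "c \<otimes> x \<otimes> d \<in> fin_rprod G U (m + j)" if "x \<in> fin_rprod G V (m + j)" for x j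
    using that
  proof (induction j arbitrary: x)
    case 0
    then show ?case using V(2) by (auto simp: W_def)
  next
    case (Suc j)
    then obtain y v where x: "x = y \<otimes> v" and y: "y \<in> fin_rprod G V (m + j)" and v: "v \<in> V (Suc (m + j))"
      by (auto simp: set_mult_def)
    have G: "y \<in> carrier G" "v \<in> carrier G"
      using y v fin_rprod_grp[OF V(1)] base_carrier V(1) grp_carrier by blast+
    have "(c \<otimes> y \<otimes> d) \<otimes> (inv d \<otimes> v \<otimes> d) \<in> fin_rprod G U (Suc (m + j))"
    proof (rule fin_rprod_Suc_I)
      show "inv d \<otimes> v \<otimes> d \<in> U (Suc (m + j))"
        using V(3)[of "Suc (m + j)"] v by (auto simp: X_def)
    qed (rule Suc.IH[OF y])
    moreover have "d \<otimes> (inv d \<otimes> (v \<otimes> d)) = v \<otimes> d"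
      using G d by (simp add: m_assoc[symmetric])
    then have "(c \<otimes> y \<otimes> d) \<otimes> (inv d \<otimes> v \<otimes> d) = c \<otimes> x \<otimes> d"
      using G c d x by (simp add: m_assoc)
    ultimately show ?case by simp
  qed
  show ?thesis
  proof
    fix x assume "x \<in> rprod G V"
    then obtain i where "x \<in> fin_rprod G V i" by (auto simp: rprod_def)
    then have "x \<in> fin_rprod G V (m + i)" using fin_rprod_le[OF V(1), of i "m + i"] by auto
    then show "c \<otimes> x \<otimes> d \<in> rprod G U" using * by (auto simp: rprod_def)
  qed fact
qed

end

section \<open>Balanced towers\<close>

locale balanced_based_tower = based_tower +
  assumes balanced: "balanced_tower G T"
begin

lemma base_nbhd: "U \<in> \<B> n \<Longrightarrow> nbhd (T n) \<one> U"
  using base_open base_one base_grp by (simp add: nbhd_def interior_of_openin)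

lemma base_product:
  assumes "openin (T n) W" "\<one> \<in> W"
  obtains V where "V \<in> \<B> n" "\<And>x y. x \<in> V \<Longrightarrow> y \<in> V \<Longrightarrow> x \<otimes> y \<in> W"
proof -
  from assms(2) obtain A where A: "openin (T n) A" "\<one> \<in> A" "A <#> A \<subseteq> W"
    by (rule topological_group_half[OF topological_group_grp assms(1), unfolded tower_group_simps]) blast
  obtain V where V: "V \<in> \<B> n" "V \<subseteq> A" using base_exists[OF A(1,2)] .
  have "x \<otimes> y \<in> W" if "x \<in> V" "y \<in> V" for x y
    using that V(2) A(3) by (auto simp: set_mult_def)
  with V(1) show ?thesis by (rule that)
qed

text \<open>Balancedness of the triple of levels \<open>k + 2\<close>, \<open>k + 1\<close>,
  \<open>k\<close>, in the form used for reordering. The conjugates are written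
  \<open>inv h \<otimes> q \<otimes> h\<close> because moving \<open>q\<close> to the right past
  \<open>h\<close> uses \<open>q h = h (inv h q h)\<close>; \<open>grp k\<close> is closed under
  inverses, so this agrees with \<open>conj_root\<close>.\<close>

lemma balanced_step:
  assumes P: "P \<in> \<B> (Suc k)" and Q: "Q \<in> \<B> (Suc (Suc k))"
  obtains X where "X \<in> \<B> (Suc (Suc k))"
    "\<And>x y. x \<in> X \<Longrightarrow> y \<in> X \<Longrightarrow> \<exists>p\<in>P. \<exists>q\<in>carrier G. x \<otimes> y = p \<otimes> q \<and> (\<forall>h\<in>grp k. inv h \<otimes> q \<otimes> h \<in> Q)"
proof -
  let ?K = "tower_group G T (Suc (Suc k))"
  let ?R = "conj_root ?K (grp k) Q"
  have "balanced_triple ?K (T (Suc (Suc k))) (T (Suc k)) (grp k)"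
    using balanced by (simp add: balanced_tower_def)
  then have "nbhd (T (Suc (Suc k))) \<one> (P <#> ?R)"
    using base_nbhd[OF P] base_nbhd[OF Q] by (auto simp: balanced_triple_def)
  then have "\<one> \<in> T (Suc (Suc k)) interior_of (P <#> ?R)" by (simp add: nbhd_def)
  \<comment> \<open>Neighborhoods need not be open, so halving is applied to the interior.\<close>
  then obtain X where X: "X \<in> \<B> (Suc (Suc k))"
     "\<And>x y. x \<in> X \<Longrightarrow> y \<in> X \<Longrightarrow> x \<otimes> y \<in> T (Suc (Suc k)) interior_of (P <#> ?R)"
    using base_product[OF openin_interior_of] by blast
  have root: "inv h \<otimes> q \<otimes> h \<in> Q" if q: "q \<in> ?R" and h: "h \<in> grp k" for q h
  proof -
    have "grp k \<subseteq> grp (Suc (Suc k))" by (rule grp_mono) simp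
    then have h': "inv h \<in> grp (Suc (Suc k))" using h by auto
    have "inv h \<otimes> q \<otimes> inv\<^bsub>?K\<^esub> (inv h) \<in> Q"
      using q h unfolding conj_root_def by simp
    then show ?thesis using tower_group_inv[OF h'] h grp_carrier by simp
  qed
  show ?thesis
  proof
    fix x y assume "x \<in> X" "y \<in> X"
    then have "x \<otimes> y \<in> P <#> ?R" by (rule subsetD[OF interior_of_subset X(2)])
    then obtain p q where "p \<in> P" "q \<in> ?R" "x \<otimes> y = p \<otimes> q"
      by (auto simp: set_mult_def)
    moreover from this have "q \<in> carrier G" using grp_carrier by (auto simp: conj_root_def)
    ultimately show "\<exists>p\<in>P. \<exists>q\<in>carrier G. x \<otimes> y = p \<otimes> q \<and> (\<forall>h\<in>grp k. inv h \<otimes> q \<otimes> h \<in> Q)"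
      using root by blast
  qed fact
qed

text \<open>Dependent choice over \<open>balanced_step\<close>. The index is shifted:
  \<open>P k\<close> lives in level \<open>Suc k\<close>, and a product of two elements of
  \<open>P (Suc k)\<close> leaves its large part one level lower in \<open>P k\<close>. Fourfold
  products at the bottom cover the base cases of both reordering arguments.\<close>

lemma balanced_chain:
  assumes Q: "base_seq Q" and U: "U \<in> \<B> 1"
  obtains P where "\<And>k. P k \<in> \<B> (Suc k)"
    "\<And>a b c d. a \<in> P 0 \<Longrightarrow> b \<in> P 0 \<Longrightarrow> c \<in> P 0 \<Longrightarrow> d \<in> P 0 \<Longrightarrow> (a \<otimes> b) \<otimes> (c \<otimes> d) \<in> U"
    "\<And>k x y. x \<in> P (Suc k) \<Longrightarrow> y \<in> P (Suc k) \<Longrightarrow>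
       \<exists>p\<in>P k. \<exists>q\<in>carrier G. x \<otimes> y = p \<otimes> q \<and> (\<forall>h\<in>grp k. inv h \<otimes> q \<otimes> h \<in> Q (Suc (Suc k)))"
proof -
  define start where "start P \<longleftrightarrow>
    (\<forall>a\<in>P. \<forall>b\<in>P. \<forall>c\<in>P. \<forall>d\<in>P. (a \<otimes> b) \<otimes> (c \<otimes> d) \<in> U)" for P
  define step where "step k P X \<longleftrightarrow> (\<forall>x\<in>X. \<forall>y\<in>X. \<exists>p\<in>P. \<exists>q\<in>carrier G. x \<otimes> y = p \<otimes> q \<and>
    (\<forall>h\<in>grp k. inv h \<otimes> q \<otimes> h \<in> Q (Suc (Suc k))))" for k P X
  have "\<exists>P. \<forall>k. (P k \<in> \<B> (Suc k) \<and> (k = 0 \<longrightarrow> start (P k))) \<and> step k (P k) (P (Suc k))"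
  proof (rule dependent_nat_choice)
    obtain V where V: "V \<in> \<B> 1" "\<And>x y. x \<in> V \<Longrightarrow> y \<in> V \<Longrightarrow> x \<otimes> y \<in> U"
      using base_product[OF base_open[OF U] base_one[OF U]] by blast
    obtain P where "P \<in> \<B> 1" "\<And>x y. x \<in> P \<Longrightarrow> y \<in> P \<Longrightarrow> x \<otimes> y \<in> V"
      using base_product[OF base_open[OF V(1)] base_one[OF V(1)]] by blast
    then show "\<exists>P. P \<in> \<B> (Suc 0) \<and> ((0::nat) = 0 \<longrightarrow> start P)"
      using V(2) by (auto simp: start_def)
  next
    fix P and k :: nat assume "P \<in> \<B> (Suc k) \<and> (k = 0 \<longrightarrow> start P)"
    then obtain X where "X \<in> \<B> (Suc (Suc k))" "step k P X"
      unfolding step_def using balanced_step[of P k "Q (Suc (Suc k))"] Q by metis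
    then show "\<exists>X. (X \<in> \<B> (Suc (Suc k)) \<and> (Suc k = 0 \<longrightarrow> start X)) \<and> step k P X" by auto
  qed
  then obtain P where P: "\<And>k. P k \<in> \<B> (Suc k)" "start (P 0)" "\<And>k. step k (P k) (P (Suc k))"
    by blast
  show ?thesis
  proof
    show "(a \<otimes> b) \<otimes> (c \<otimes> d) \<in> U" if "a \<in> P 0" "b \<in> P 0" "c \<in> P 0" "d \<in> P 0" for a b c d
      using P(2) that by (simp add: start_def)
    show "\<exists>p\<in>P k. \<exists>q\<in>carrier G. x \<otimes> y = p \<otimes> q \<and> (\<forall>h\<in>grp k. inv h \<otimes> q \<otimes> h \<in> Q (Suc (Suc k)))"
      if "x \<in> P (Suc k)" "y \<in> P (Suc k)" for k x y
      using P(3)[of k] that unfolding step_def by simp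
  qed (rule P(1))
qed

text \<open>From the top index downwards, the last factor \<open>v\<close> of the first product is
  merged with the slot \<open>p\<close> and split as \<open>p' q\<close>. The part \<open>p'\<close>
  becomes the slot one level below, while \<open>q\<close> travels right across the second product
  and joins its last factor.\<close>

lemma rprod_mult:
  assumes U: "base_seq U"
  obtains V where "base_seq V" "rprod G V <#> rprod G V \<subseteq> rprod G U"
proof -
  \<comment> \<open>Squares of \<open>Q i\<close> fit into \<open>U i\<close> because two elements
    end up in one factor: the conjugated \<open>q\<close> and the last factor \<open>w\<close> of
    the second product.\<close>
  have "\<exists>Q. Q \<in> \<B> i \<and> (\<forall>x\<in>Q. \<forall>y\<in>Q. x \<otimes> y \<in> U i)" for i
  proof -
    have Ui: "U i \<in> \<B> i" using U by blast
    show ?thesis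
      by (rule base_product[OF base_open[OF Ui] base_one[OF Ui]]) blast
  qed
  then obtain Q where "\<forall>i. Q i \<in> \<B> i \<and> (\<forall>x\<in>Q i. \<forall>y\<in>Q i. x \<otimes> y \<in> U i)"
    by metis
  then have Q: "base_seq Q" "\<And>i x y. x \<in> Q i \<Longrightarrow> y \<in> Q i \<Longrightarrow> x \<otimes> y \<in> U i"
    by blast+
  obtain P where P: "\<And>k. P k \<in> \<B> (Suc k)"
    "\<And>a b c d. a \<in> P 0 \<Longrightarrow> b \<in> P 0 \<Longrightarrow> c \<in> P 0 \<Longrightarrow> d \<in> P 0 \<Longrightarrow> (a \<otimes> b) \<otimes> (c \<otimes> d) \<in> U 1"
    "\<And>k x y. x \<in> P (Suc k) \<Longrightarrow> y \<in> P (Suc k) \<Longrightarrow>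
       \<exists>p\<in>P k. \<exists>q\<in>carrier G. x \<otimes> y = p \<otimes> q \<and> (\<forall>h\<in>grp k. inv h \<otimes> q \<otimes> h \<in> Q (Suc (Suc k)))"
    using balanced_chain[OF Q(1), of "U 1"] U by blast
  \<comment> \<open>\<open>P k\<close> already lives in level \<open>Suc k\<close>. The other
    conditions concern the next level up and are pulled back along the inclusion, since
    \<open>w\<close> from level \<open>Suc k\<close> has to be absorbed in
    \<open>U (Suc (Suc k))\<close>.\<close>
  define X where "X i = (case i of 0 \<Rightarrow> {x \<in> grp 0. id x \<in> P 0}
     | Suc k \<Rightarrow> P k \<inter> {x \<in> grp (Suc k). id x \<in> Q (Suc (Suc k))})" for i
  have "openin (T i) (X i)" for i
    using openin_continuous_map_preimage[OF continuous_map_grp[of i "Suc i"] base_open] P(1) Q(1) base_open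
    by (auto simp: X_def split: nat.split)
  moreover have "\<one> \<in> X i" for i
    using base_one P(1) Q(1) by (auto simp: X_def split: nat.split)
  ultimately obtain V where V: "base_seq V" "\<And>i. V i \<subseteq> X i"
    using base_seq_exists[of X] by blast
  have V0: "V 0 \<subseteq> P 0" and VP: "V (Suc k) \<subseteq> P k" and VQ: "V (Suc k) \<subseteq> Q (Suc (Suc k))" for k
    using V(2)[of 0] V(2)[of "Suc k"] by (auto simp: X_def)
  have PG: "P k \<subseteq> carrier G" for k using P(1) base_carrier by blast
  have VG: "V k \<subseteq> carrier G" for k using V(1) base_carrier by blast
  \<comment> \<open>The slot \<open>p\<close> between the two products absorbs the \<open>P\<close>-parts of the top factors of \<open>a\<close>.\<close>
  have key: "a \<otimes> p \<otimes> b \<in> fin_rprod G U (Suc k)"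
    if "a \<in> fin_rprod G V (Suc k)" "p \<in> P k" "b \<in> fin_rprod G V k" for a p b k
    using that
  proof (induction k arbitrary: a p b)
    case 0
    then obtain v w where a: "a = v \<otimes> w" "v \<in> V 0" "w \<in> V 1" by (auto simp: set_mult_def)
    have b: "b \<in> V 0" using 0 by simp
    \<comment> \<open>All four remaining elements go into the single factor \<open>U 1\<close>, with
      \<open>\<one>\<close> standing in for the factor from \<open>U 0\<close>.\<close>
    have "(v \<otimes> w) \<otimes> (p \<otimes> b) \<in> U 1"
      using a b 0 V0 VP[of 0] by (intro P(2)) auto
    moreover have "a \<otimes> p \<otimes> b = (v \<otimes> w) \<otimes> (p \<otimes> b)"
      using a b 0 VG PG by (simp add: m_assoc subsetD[OF VG] subsetD[OF PG])
    ultimately show ?case using base_subset_fin_rprod[OF U, of 1] by auto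
  next
    case (Suc k)
    obtain a' v where a: "a = a' \<otimes> v" "a' \<in> fin_rprod G V (Suc k)" "v \<in> V (Suc (Suc k))"
      using Suc.prems(1) by (auto simp: set_mult_def)
    obtain b' w where b: "b = b' \<otimes> w" "b' \<in> fin_rprod G V k" "w \<in> V (Suc k)"
      using Suc.prems(3) by (auto simp: set_mult_def)
    have "v \<in> P (Suc k)" using a(3) VP by blast
    from P(3)[OF this Suc.prems(2)]
    obtain p' q where p': "p' \<in> P k" "q \<in> carrier G" "v \<otimes> p = p' \<otimes> q"
      and q: "\<forall>h\<in>grp k. inv h \<otimes> q \<otimes> h \<in> Q (Suc (Suc k))" by blast
    have G: "a' \<in> carrier G" "b' \<in> carrier G" "p' \<in> carrier G" "v \<in> carrier G" "w \<in> carrier G"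
      "p \<in> carrier G"
      using a b p' VG PG Suc.prems(2) fin_rprod_grp[OF V(1)] grp_carrier by blast+
    \<comment> \<open>Removing \<open>w\<close> leaves \<open>b'\<close> in \<open>grp k\<close>,
      exactly the group whose conjugations are controlled.\<close>
    have "inv b' \<otimes> q \<otimes> b' \<in> Q (Suc (Suc k))"
      using q b(2) fin_rprod_grp[OF V(1)] by blast
    then have "(inv b' \<otimes> q \<otimes> b') \<otimes> w \<in> U (Suc (Suc k))"
      using Q(2) b(3) VQ by blast
    from fin_rprod_Suc_I[where U = U, OF Suc.IH[OF a(2) p'(1) b(2)] this]
    have "(a' \<otimes> p' \<otimes> b') \<otimes> ((inv b' \<otimes> q \<otimes> b') \<otimes> w) \<in> fin_rprod G U (Suc (Suc k))" .
    moreover have "(a' \<otimes> p' \<otimes> b') \<otimes> ((inv b' \<otimes> q \<otimes> b') \<otimes> w) = a \<otimes> p \<otimes> b"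
    proof -
      have "b' \<otimes> (inv b' \<otimes> (q \<otimes> (b' \<otimes> w))) = q \<otimes> (b' \<otimes> w)"
        using G p' by (simp add: m_assoc[symmetric])
      then have "(a' \<otimes> p' \<otimes> b') \<otimes> ((inv b' \<otimes> q \<otimes> b') \<otimes> w) = a' \<otimes> (p' \<otimes> q) \<otimes> (b' \<otimes> w)"
        using G p' by (simp add: m_assoc)
      also have "\<dots> = a \<otimes> p \<otimes> b"
        unfolding p'(3)[symmetric] using G a b by (simp add: m_assoc)
      finally show ?thesis .
    qed
    ultimately show ?case by simp
  qed
  have "rprod G V <#> rprod G V \<subseteq> rprod G U"
  proof
    fix z assume "z \<in> rprod G V <#> rprod G V"
    then obtain a b i j where ab: "z = a \<otimes> b" "a \<in> fin_rprod G V i" "b \<in> fin_rprod G V j"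
      by (auto simp: rprod_def set_mult_def)
    \<comment> \<open>The first product is padded to one index more than the second, as
      \<open>key\<close> requires, and the slot is filled with \<open>\<one>\<close>.\<close>
    define k where "k = max i j"
    have "i \<le> Suc k" "j \<le> k" by (auto simp: k_def)
    then have "a \<in> fin_rprod G V (Suc k)" "b \<in> fin_rprod G V k"
      using ab fin_rprod_le[OF V(1)] by blast+
    moreover have "\<one> \<in> P k" using base_one P(1) by blast
    ultimately have "a \<otimes> \<one> \<otimes> b \<in> fin_rprod G U (Suc k)" by (intro key)
    moreover have "a \<in> carrier G" using ab(2) fin_rprod_grp[OF V(1)] grp_carrier by blast
    then have "a \<otimes> \<one> \<otimes> b = z" using ab(1) by simp
    ultimately show "z \<in> rprod G U" unfolding rprod_def by blast
  qed
  with V(1) show ?thesis using that by blast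
qed

text \<open>The same descent as for products of two right products. In a left product the factor of
  largest index stands first; its small part \<open>q\<close> is carried to the far right, where a
  right product has that factor.\<close>

lemma lprod_subset_rprod:
  assumes U: "base_seq U"
  obtains V where "base_seq V" "lprod G V \<subseteq> rprod G U"
proof -
  obtain P where P: "\<And>k. P k \<in> \<B> (Suc k)"
    "\<And>a b c d. a \<in> P 0 \<Longrightarrow> b \<in> P 0 \<Longrightarrow> c \<in> P 0 \<Longrightarrow> d \<in> P 0 \<Longrightarrow> (a \<otimes> b) \<otimes> (c \<otimes> d) \<in> U 1"
    "\<And>k x y. x \<in> P (Suc k) \<Longrightarrow> y \<in> P (Suc k) \<Longrightarrow>
       \<exists>p\<in>P k. \<exists>q\<in>carrier G. x \<otimes> y = p \<otimes> q \<and> (\<forall>h\<in>grp k. inv h \<otimes> q \<otimes> h \<in> U (Suc (Suc k)))"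
    using balanced_chain[OF U, of "U 1"] U by blast
  \<comment> \<open>Pulling \<open>P (Suc k)\<close> back from level \<open>Suc (Suc k)\<close> puts
    a factor of index \<open>Suc k\<close> into the same set as the slot with which it is
    merged.\<close>
  define X where "X i = (case i of 0 \<Rightarrow> {x \<in> grp 0. id x \<in> P 0}
     | Suc k \<Rightarrow> P k \<inter> {x \<in> grp (Suc k). id x \<in> P (Suc k)})" for i
  have "openin (T i) (X i)" for i
    using openin_continuous_map_preimage[OF continuous_map_grp[of i "Suc i"] base_open] P(1) base_open
    by (auto simp: X_def split: nat.split)
  moreover have "\<one> \<in> X i" for i
    using base_one P(1) by (auto simp: X_def split: nat.split)
  ultimately obtain V where V: "base_seq V" "\<And>i. V i \<subseteq> X i"
    using base_seq_exists[of X] by blast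
  have V0: "V k \<subseteq> P k" and VP: "V (Suc k) \<subseteq> P k" for k
    using V(2)[of k] V(2)[of "Suc k"] by (auto simp: X_def split: nat.splits)
  have PG: "P k \<subseteq> carrier G" for k using P(1) base_carrier by blast
  have VG: "V k \<subseteq> carrier G" for k using V(1) base_carrier by blast
  \<comment> \<open>The slot \<open>p\<close> in front collects what is left of factors already
    treated. With \<open>p v = p' q\<close> one has \<open>p v b' = (p' b') (inv b' q b')\<close>;
    the first bracket falls under the induction hypothesis and the second is the new last
    factor.\<close>
  have key: "p \<otimes> b \<in> fin_rprod G U (Suc k)"
    if "p \<in> P k" "b \<in> fin_lprod G V k" for p b k
    using that
  proof (induction k arbitrary: p b)
    case 0
    have "b \<in> P 0" using 0 V0 by auto
    then have "(p \<otimes> b) \<otimes> (\<one> \<otimes> \<one>) \<in> U 1"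
      using 0 base_one P(1) by (intro P(2)) auto
    moreover have "p \<in> carrier G" "b \<in> carrier G" using 0 \<open>b \<in> P 0\<close> PG by auto
    ultimately show ?case using base_subset_fin_rprod[OF U, of 1] by auto
  next
    case (Suc k)
    obtain b' v where b: "b = v \<otimes> b'" "b' \<in> fin_lprod G V k" "v \<in> V (Suc k)"
      using Suc.prems(2) by (auto simp: set_mult_def)
    have "v \<in> P (Suc k)" using b(3) V0 by blast
    from P(3)[OF Suc.prems(1) this]
    obtain p' q where p': "p' \<in> P k" "q \<in> carrier G" "p \<otimes> v = p' \<otimes> q"
      and q: "\<forall>h\<in>grp k. inv h \<otimes> q \<otimes> h \<in> U (Suc (Suc k))" by blast
    have G: "b' \<in> carrier G" "p' \<in> carrier G" "v \<in> carrier G" "p \<in> carrier G"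
      using b p' VG PG Suc.prems(1) fin_lprod_grp[OF V(1)] grp_carrier by blast+
    have "inv b' \<otimes> q \<otimes> b' \<in> U (Suc (Suc k))"
      using q b(2) fin_lprod_grp[OF V(1)] by blast
    from fin_rprod_Suc_I[where U = U, OF Suc.IH[OF p'(1) b(2)] this]
    have "(p' \<otimes> b') \<otimes> (inv b' \<otimes> q \<otimes> b') \<in> fin_rprod G U (Suc (Suc k))" .
    moreover have "(p' \<otimes> b') \<otimes> (inv b' \<otimes> q \<otimes> b') = p \<otimes> b"
    proof -
      have "b' \<otimes> (inv b' \<otimes> (q \<otimes> b')) = q \<otimes> b'"
        using G p' by (simp add: m_assoc[symmetric])
      then have "(p' \<otimes> b') \<otimes> (inv b' \<otimes> q \<otimes> b') = (p' \<otimes> q) \<otimes> b'"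
        using G p' by (simp add: m_assoc)
      also have "\<dots> = p \<otimes> b"
        unfolding p'(3)[symmetric] using G b by (simp add: m_assoc)
      finally show ?thesis .
    qed
    ultimately show ?case by simp
  qed
  have "lprod G V \<subseteq> rprod G U"
  proof
    fix b assume "b \<in> lprod G V"
    then obtain k where k: "b \<in> fin_lprod G V k" by (auto simp: lprod_def)
    have "\<one> \<otimes> b \<in> fin_rprod G U (Suc k)"
      using k base_one P(1) by (intro key) auto
    moreover have "b \<in> carrier G" using k fin_lprod_grp[OF V(1)] grp_carrier by blast
    then have "\<one> \<otimes> b = b" by simp
    ultimately show "b \<in> rprod G U" unfolding rprod_def by (metis UN_I UNIV_I)
  qed
  with V(1) show ?thesis using that by blast
qed

section \<open>The limit topology and its bases\<close>

lemma ex_base_seq: "\<exists>U. base_seq U"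
  by (rule base_seq_exists[of grp]) auto

text \<open>The right products satisfy the filter base axioms: \<open>rprod_translation\<close>
  gives translations, \<open>rprod_mult\<close> gives squares, and \<open>lprod_subset_rprod\<close>
  gives inverses. The description of the open sets is kept for comparison with other group
  topologies.\<close>

lemma topological_group_rprod:
  obtains S where "topological_group G S"
    "\<And>D. openin S D \<longleftrightarrow> D \<subseteq> carrier G \<and> (\<forall>x\<in>D. \<exists>U. base_seq U \<and> rprod G U #> x \<subseteq> D)"
    "\<And>U x. base_seq U \<Longrightarrow> x \<in> carrier G \<Longrightarrow> openin S (rprod G U #> x)"
proof -
  define N where "N = {rprod G U | U. base_seq U}"
  have NE: "\<exists>W\<in>N. F W" if "base_seq V" "F (rprod G V)" for V F
    using that unfolding N_def by blast
  note grp = group_axioms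
  moreover have "N \<noteq> {}" using ex_base_seq by (auto simp: N_def)
  moreover have "U \<subseteq> carrier G" "\<one> \<in> U" if "U \<in> N" for U
    using that rprod_carrier rprod_one by (auto simp: N_def)
  moreover have "\<exists>W\<in>N. W \<subseteq> U \<inter> V" if UV: "U \<in> N" "V \<in> N" for U V
  proof -
    obtain U' V' where *: "base_seq U'" "base_seq V'" "U = rprod G U'" "V = rprod G V'"
      using UV by (auto simp: N_def)
    obtain W where W: "base_seq W" "\<And>i. W i \<subseteq> U' i" "\<And>i. W i \<subseteq> V' i"
      using base_seq_inter[OF *(1,2)] by blast
    have "rprod G W \<subseteq> rprod G U'" "rprod G W \<subseteq> rprod G V'"
      by (rule rprod_mono, rule W)+
    then have "rprod G W \<subseteq> U \<inter> V" using * by simp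
    then show ?thesis by (rule NE[OF W(1)])
  qed
  moreover have "\<exists>V\<in>N. \<forall>x\<in>V. c \<otimes> x \<otimes> d \<in> U"
    if U: "U \<in> N" and cd: "c \<in> carrier G" "d \<in> carrier G" "c \<otimes> d \<in> U" for U c d
  proof -
    obtain U' where U': "base_seq U'" "U = rprod G U'" using U by (auto simp: N_def)
    obtain V where V: "base_seq V" "\<And>x. x \<in> rprod G V \<Longrightarrow> c \<otimes> x \<otimes> d \<in> rprod G U'"
      using rprod_translation[OF U'(1) cd(1,2)] cd(3) U'(2) by blast
    then show ?thesis using NE[OF V(1), of "\<lambda>V. \<forall>x\<in>V. c \<otimes> x \<otimes> d \<in> U"] U'(2) by blast
  qed
  moreover have "\<exists>V\<in>N. V <#> V \<subseteq> U" if "U \<in> N" for U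
    using that rprod_mult NE[where F = "\<lambda>V. V <#> V \<subseteq> U"] by (auto simp: N_def)
  \<comment> \<open>The inverse of a right product is the corresponding left product, so this is
    \<open>lprod_subset_rprod\<close>.\<close>
  moreover have "\<exists>V\<in>N. set_inv V \<subseteq> U" if UN: "U \<in> N" for U
  proof -
    obtain U' where U': "base_seq U'" "U = rprod G U'" using UN by (auto simp: N_def)
    obtain V where "base_seq V" "lprod G V \<subseteq> rprod G U'" using lprod_subset_rprod[OF U'(1)] .
    then show ?thesis using NE[of V] set_inv_rprod U' by simp
  qed
  ultimately have "\<exists>S. topological_group G S \<and>
    (\<forall>D. openin S D \<longleftrightarrow> D \<subseteq> carrier G \<and> (\<forall>x\<in>D. \<exists>U\<in>N. U #> x \<subseteq> D)) \<and>
    (\<forall>U\<in>N. \<forall>x\<in>carrier G. openin S (U #> x))"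
    by (rule topological_group_of_filter_base)
  then obtain S where S: "topological_group G S"
    "\<And>D. openin S D \<longleftrightarrow> D \<subseteq> carrier G \<and> (\<forall>x\<in>D. \<exists>U\<in>N. U #> x \<subseteq> D)"
    "\<And>U x. U \<in> N \<Longrightarrow> x \<in> carrier G \<Longrightarrow> openin S (U #> x)"
    by metis
  show ?thesis
  proof
    show "openin S D \<longleftrightarrow> D \<subseteq> carrier G \<and> (\<forall>x\<in>D. \<exists>U. base_seq U \<and> rprod G U #> x \<subseteq> D)" for D
      unfolding S(2) N_def by blast
    show "openin S (rprod G U #> x)" if "base_seq U" "x \<in> carrier G" for U x
      using that S(3) by (auto simp: N_def)
  qed fact
qed

lemma glim_eqI:
  assumes "admissible G T S" "\<And>S' D. admissible G T S' \<Longrightarrow> openin S' D \<Longrightarrow> openin S D"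
  shows "glim G T = S"
  unfolding glim_def using strongest_admissible_ex1[OF tower] assms by (intro the1_equality) blast+

text \<open>Inclusions are continuous because \<open>U n\<close> lies in \<open>rprod G U\<close>,
  so basic neighborhoods contain open translates in each level. The topology is the strongest
  admissible one because, by halving, every neighborhood in an admissible topology contains a
  translated right product.\<close>

lemma limit_topology:
  obtains S where "topological_group G S" "admissible G T S" "glim G T = S"
    "\<And>D x. openin S D \<Longrightarrow> x \<in> D \<Longrightarrow> \<exists>U. base_seq U \<and> rprod G U #> x \<subseteq> D"
    "\<And>U x. base_seq U \<Longrightarrow> x \<in> carrier G \<Longrightarrow> openin S (rprod G U #> x)"
proof -
  obtain S where S: "topological_group G S"
    "\<And>D. openin S D \<longleftrightarrow> D \<subseteq> carrier G \<and> (\<forall>x\<in>D. \<exists>U. base_seq U \<and> rprod G U #> x \<subseteq> D)"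
    "\<And>U x. base_seq U \<Longrightarrow> x \<in> carrier G \<Longrightarrow> openin S (rprod G U #> x)"
    by (rule topological_group_rprod) blast
  have top: "topspace S = carrier G" using S(1) by (simp add: topological_group_def)
  have "continuous_map (T n) S id" for n
    unfolding continuous_map_def
  proof (intro conjI allI impI)
    show "id \<in> grp n \<rightarrow> topspace S" using top grp_carrier by auto
    fix D assume D: "openin S D"
    show "openin (T n) {x \<in> grp n. id x \<in> D}"
    proof (subst openin_subopen, intro ballI)
      fix x assume "x \<in> {x \<in> grp n. id x \<in> D}"
      then have x: "x \<in> grp n" "x \<in> D" by auto
      then obtain U where U: "base_seq U" "rprod G U #> x \<subseteq> D" using D S(2) by blast
      have Un: "U n \<in> \<B> n" using U(1) by blast
      have "openin (T n) (U n #> x)"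
        using topological_group_openin_r_coset[OF topological_group_grp, of x n "U n"] x(1) base_open[OF Un]
        by simp
      moreover have "x \<in> U n #> x"
        using base_one[OF Un] l_one[OF grp_carrier[OF x(1)]] unfolding r_coset_def by force
      moreover have "U n #> x \<subseteq> rprod G U #> x"
        using base_subset_rprod[OF U(1), of n] by (auto simp: r_coset_def)
      moreover have "U n #> x \<subseteq> grp n"
        using base_grp[OF Un] x(1) by (auto simp: r_coset_def)
      ultimately show "\<exists>V. openin (T n) V \<and> x \<in> V \<and> V \<subseteq> {x \<in> grp n. id x \<in> D}"
        using U(2) by (intro exI[of _ "U n #> x"]) auto
    qed
  qed
  then have adm: "admissible G T S" using S(1) by (simp add: admissible_def)
  have "glim G T = S"
  proof (rule glim_eqI[OF adm])
    fix S' D assume "admissible G T S'" and D: "openin S' D"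
    then have S': "topological_group G S'" "\<And>n. continuous_map (T n) S' id"
      by (simp_all add: admissible_def)
    have DG: "D \<subseteq> carrier G" using openin_subset[OF D] S'(1) by (simp add: topological_group_def)
    show "openin S D"
      unfolding S(2)
    proof (intro conjI ballI)
      fix x assume x: "x \<in> D"
      then have xG: "x \<in> carrier G" using DG by blast
      \<comment> \<open>\<open>D\<close> is translated back to the identity, where
        \<open>rprod_small\<close> applies.\<close>
      have "\<one> \<in> {y \<in> carrier G. \<one> \<otimes> y \<otimes> x \<in> D}" using x xG by simp
      then obtain U where U: "base_seq U" "rprod G U \<subseteq> {y \<in> carrier G. \<one> \<otimes> y \<otimes> x \<in> D}"
        by (rule rprod_small[OF S' topological_group_openin_translation[OF S'(1) one_closed xG D]])
      have "rprod G U #> x \<subseteq> D" using U(2) by (auto simp: r_coset_def)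
      with U(1) show "\<exists>U. base_seq U \<and> rprod G U #> x \<subseteq> D" by blast
    qed (rule DG)
  qed
  then show ?thesis using that[of S] S adm by blast
qed

text \<open>For each family, all its members are open in the limit topology and every point of an
  open set has a member around it inside that set. The topology generated by the family is then the
  limit topology itself.\<close>

lemma limit_topologies:
  shows "right_topology G \<B> = glim G T" "left_topology G \<B> = glim G T"
    "meet_topology G \<B> = glim G T" "twosided_topology G \<B> = glim G T"
    "topological_group G (glim G T)"
proof -
  define S where "S = glim G T"
  have tg: "topological_group G S" and adm: "admissible G T S"
    and right_nbhd: "\<And>D x. openin S D \<Longrightarrow> x \<in> D \<Longrightarrow> \<exists>U. base_seq U \<and> rprod G U #> x \<subseteq> D"
    and right_open: "\<And>U x. base_seq U \<Longrightarrow> x \<in> carrier G \<Longrightarrow> openin S (rprod G U #> x)"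
    unfolding S_def by (rule limit_topology; blast)+
  have top: "topspace S = carrier G" using tg by (simp add: topological_group_def)
  have memG: "x \<in> carrier G" if "openin S D" "x \<in> D" for D x
    using openin_subset[OF that(1)] that(2) top by blast
  have cont: "continuous_map (T n) S id" for n using adm by (simp add: admissible_def)
  have rprod_open: "openin S (rprod G U)" if "base_seq U" for U
    using right_open[OF that one_closed] rprod_carrier[OF that] by simp
  have lprod_open: "openin S (lprod G U)" if "base_seq U" for U
    using topological_group_openin_set_inv[OF tg rprod_open[OF that]] set_inv_rprod[OF that] by simp
  \<comment> \<open>Applying the halving argument to \<open>set_inv D\<close> and inverting turns
    right products into left ones.\<close>
  have lprod_small: "\<exists>U. base_seq U \<and> lprod G U \<subseteq> D" if D: "openin S D" "\<one> \<in> D" for D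
  proof -
    have "\<one> \<in> set_inv D" using D(2) by (force simp: SET_INV_def)
    then obtain U where U: "base_seq U" "rprod G U \<subseteq> set_inv D"
      by (rule rprod_small[OF tg cont topological_group_openin_set_inv[OF tg D(1)]])
    have "lprod G U \<subseteq> set_inv (set_inv D)"
      unfolding set_inv_rprod[OF U(1), symmetric] using U(2) by (auto simp: SET_INV_def)
    also have "\<dots> \<subseteq> D" using memG[OF D(1)] by (auto simp: SET_INV_def)
    finally show ?thesis using U(1) by blast
  qed
  have left_nbhd: "\<exists>U. base_seq U \<and> x <# lprod G U \<subseteq> D" if D: "openin S D" "x \<in> D" for D x
  proof -
    have xG: "x \<in> carrier G" using memG D .
    have "\<one> \<in> {y \<in> carrier G. x \<otimes> y \<otimes> \<one> \<in> D}" using D(2) xG by simp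
    then obtain U where U: "base_seq U" "lprod G U \<subseteq> {y \<in> carrier G. x \<otimes> y \<otimes> \<one> \<in> D}"
      using lprod_small[OF topological_group_openin_translation[OF tg xG one_closed D(1)]] by blast
    then have "x <# lprod G U \<subseteq> D" using xG by (auto simp: l_coset_def)
    with U(1) show ?thesis by blast
  qed
  have self_r: "x \<in> rprod G U #> x" if "base_seq U" "x \<in> carrier G" for U x
    using rprod_one[OF that(1)] l_one[OF that(2)] unfolding r_coset_def by force
  have self_l: "x \<in> x <# lprod G U" if "base_seq U" "x \<in> carrier G" for U x
    using lprod_one[OF that(1)] r_one[OF that(2)] unfolding l_coset_def by force
  have left_open: "openin S (x <# lprod G U)" if "base_seq U" "x \<in> carrier G" for U x
    using that by (intro topological_group_openin_l_coset[OF tg] lprod_open)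
  have "right_topology G \<B> = S"
    unfolding right_topology_def
  proof (rule base_topology_eqI)
    show "openin S C" if "C \<in> {rprod G U #> x |U x. base_seq U \<and> x \<in> carrier G}" for C
      using that right_open by blast
    fix D x assume D: "openin S D" "x \<in> D"
    then obtain U where "base_seq U" "rprod G U #> x \<subseteq> D" using right_nbhd by blast
    then show "\<exists>C\<in>{rprod G U #> x |U x. base_seq U \<and> x \<in> carrier G}. x \<in> C \<and> C \<subseteq> D"
      using self_r memG[OF D] by blast
  qed
  moreover have "left_topology G \<B> = S"
    unfolding left_topology_def
  proof (rule base_topology_eqI)
    show "openin S C" if "C \<in> {x <# lprod G U |U x. base_seq U \<and> x \<in> carrier G}" for C
      using that left_open by blast
    fix D x assume D: "openin S D" "x \<in> D"
    then obtain U where "base_seq U" "x <# lprod G U \<subseteq> D" using left_nbhd by blast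
    then show "\<exists>C\<in>{x <# lprod G U |U x. base_seq U \<and> x \<in> carrier G}. x \<in> C \<and> C \<subseteq> D"
      using self_l memG[OF D] by blast
  qed
  moreover have "meet_topology G \<B> = S"
    unfolding meet_topology_def
  proof (rule base_topology_eqI)
    show "openin S C" if "C \<in> {(x <# lprod G U) \<inter> (rprod G U #> y) |U x y.
        base_seq U \<and> x \<in> carrier G \<and> y \<in> carrier G}" for C
      using that left_open right_open by auto
    fix D x assume D: "openin S D" "x \<in> D"
    then obtain U where U: "base_seq U" "x <# lprod G U \<subseteq> D" using left_nbhd by blast
    \<comment> \<open>Taking \<open>y = x\<close> puts \<open>x\<close> in both translates; the left
      one alone already lies in \<open>D\<close>.\<close>
    have "x \<in> (x <# lprod G U) \<inter> (rprod G U #> x)" "(x <# lprod G U) \<inter> (rprod G U #> x) \<subseteq> D"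
      using U self_l self_r memG[OF D] by auto
    then show "\<exists>C\<in>{(x <# lprod G U) \<inter> (rprod G U #> y) |U x y.
        base_seq U \<and> x \<in> carrier G \<and> y \<in> carrier G}. x \<in> C \<and> C \<subseteq> D"
      using U(1) memG[OF D] by blast
  qed
  moreover have "twosided_topology G \<B> = S"
    unfolding twosided_topology_def
  proof (rule base_topology_eqI)
    have "openin S (x <# lrprod G U #> y)" if "base_seq U" "x \<in> carrier G" "y \<in> carrier G" for U x y
      unfolding lrprod_eq[OF that(1)]
      by (intro topological_group_openin_r_coset[OF tg] topological_group_openin_l_coset[OF tg]
          topological_group_openin_set_mult[OF tg] rprod_open lprod_carrier that)
    then show "openin S C" if "C \<in> {x <# lrprod G U #> y |U x y.
        base_seq U \<and> x \<in> carrier G \<and> y \<in> carrier G}" for C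
      using that by blast
    fix D x assume D: "openin S D" "x \<in> D"
    have xG: "x \<in> carrier G" using memG[OF D] .
    have "\<one> \<in> {y \<in> carrier G. x \<otimes> y \<otimes> \<one> \<in> D}" using D(2) xG by simp
    \<comment> \<open>A two-sided product is a left product times a right product, so each half gets
      one copy of \<open>A\<close>. The whole translation is done on the left by \<open>x\<close>,
      leaving \<open>\<one>\<close> as right translate.\<close>
    then obtain A where A: "openin S A" "\<one> \<in> A" "A <#> A \<subseteq> {y \<in> carrier G. x \<otimes> y \<otimes> \<one> \<in> D}"
      by (rule topological_group_half[OF tg topological_group_openin_translation[OF tg xG one_closed D(1)]])
    obtain U where U: "base_seq U" "rprod G U \<subseteq> A" by (rule rprod_small[OF tg cont A(1,2)])
    obtain V where V: "base_seq V" "lprod G V \<subseteq> A" using lprod_small[OF A(1,2)] by blast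
    obtain W where W: "base_seq W" "\<And>i. W i \<subseteq> U i" "\<And>i. W i \<subseteq> V i"
      using base_seq_inter[OF U(1) V(1)] by blast
    have "rprod G W \<subseteq> rprod G U" "lprod G W \<subseteq> lprod G V"
      using W(2,3) by (auto intro!: rprod_mono lprod_mono del: subsetI)
    then have "lrprod G W \<subseteq> A <#> A"
      unfolding lrprod_eq[OF W(1)] using U(2) V(2) by (intro mono_set_mult) auto
    then have "x <# lrprod G W #> \<one> \<subseteq> D"
      using A(3) by (fastforce simp: l_coset_def r_coset_def)
    moreover have "x \<in> x <# lrprod G W #> \<one>"
    proof -
      have "\<one> \<otimes> \<one> \<in> lrprod G W"
        unfolding lrprod_eq[OF W(1)] set_mult_def using lprod_one[OF W(1)] rprod_one[OF W(1)] by blast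
      then have "x \<otimes> (\<one> \<otimes> \<one>) \<otimes> \<one> \<in> x <# lrprod G W #> \<one>"
        unfolding l_coset_def r_coset_def by blast
      then show ?thesis using xG by simp
    qed
    ultimately show "\<exists>C\<in>{x <# lrprod G U #> y |U x y.
        base_seq U \<and> x \<in> carrier G \<and> y \<in> carrier G}. x \<in> C \<and> C \<subseteq> D"
      using W(1) xG one_closed by blast
  qed
  ultimately show "right_topology G \<B> = glim G T" "left_topology G \<B> = glim G T"
    "meet_topology G \<B> = glim G T" "twosided_topology G \<B> = glim G T"
    "topological_group G (glim G T)"
    using tg by (simp_all add: S_def)
qed

end

theorem theorem4p2:
  fixes G :: "('a, 'b) monoid_scheme" and T :: "nat \<Rightarrow> 'a topology"
    and \<B> :: "nat \<Rightarrow> 'a set set"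
  assumes "balanced_tower G T"
    and "\<And>n. identity_base (tower_group G T n) (T n) (\<B> n)"
  shows "topological_group G (right_topology G \<B>)
    \<and> topological_group G (left_topology G \<B>)
    \<and> topological_group G (meet_topology G \<B>)
    \<and> topological_group G (twosided_topology G \<B>)
    \<and> continuous_map (twosided_topology G \<B>) (meet_topology G \<B>) id
    \<and> homeomorphic_map (meet_topology G \<B>) (glim G T) id
    \<and> homeomorphic_map (twosided_topology G \<B>) (glim G T) id
    \<and> glim G T = right_topology G \<B>
    \<and> glim G T = left_topology G \<B>
    \<and> glim G T = meet_topology G \<B>
    \<and> glim G T = twosided_topology G \<B>"
proof -
  have "group_tower G T" using assms(1) by (simp add: balanced_tower_def)
  then interpret balanced_based_tower G T \<B>
    using assms by unfold_locales
  \<comment> \<open>All four topologies equal \<open>glim G T\<close>, so the statements on the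
    identity maps concern a single topology.\<close>
  show ?thesis using limit_topologies by simp
qed

end
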